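(* Let $\mathcal{A}$ be a strong pseudo-Connes amenable dual Banach algebra. Then $\mathcal{A}$ is pseudo-Connes amenable.
   Context: A Banach algebra $\mathcal{A}$ is a dual Banach algebra if there is a closed submodule $\mathcal{A}_*$ of the dual bimodule $\mathcal{A}^*$ with $\mathcal{A}=(\mathcal{A}_* )^*$; the $wk^*$-topology on $\mathcal{A}$ is $\sigma(\mathcal{A},\mathcal{A}_* )$. For a Banach $\mathcal{A}$-bimodule $E$, $\sigma wc(E)$ is the closed submodule of all $x\in E$ such that the maps $\mathcal{A}\to E$, $a\mapsto a\cdot x$ and $a\mapsto x\cdot a$, are $wk^*$-$wk$-continuous. The projective tensor product $\mathcal{A}\hat\otimes\mathcal{A}$ is an $\mathcal{A}$-bimodule via $a\cdot(b\otimes c)=ab\otimes c$, $(b\otimes c)\cdot a=b\otimes ca$; duals carry the dual module actions. Write $\sigma wc(\mathcal{A}\hat\otimes\mathcal{A})^*$ for $\sigma wc((\mathcal{A}\hat\otimes\mathcal{A})^* )$. Let $\pi:\mathcal{A}\hat\otimes\mathcal{A}\to\mathcal{A}$, $\pi(a\otimes b)=ab$. Then $\pi^*$ maps $\mathcal{A}_*$ into $\sigma wc(\mathcal{A}\hat\otimes\mathcal{A})^*$, and $\pi_{\sigma wc}:(\sigma wc(\mathcal{A}\hat\otimes\mathcal{A})^* )^*\to\mathcal{A}$ denotes the adjoint of $\pi^*|_{\mathcal{A}_*}$; it is an $\mathcal{A}$-bimodule morphism. $\mathcal{A}$ is strong pseudo-Connes amenable if there is a (not necessarily bounded) net $(m_\alpha)$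 in $(\sigma wc(\mathcal{A}\hat\otimes\mathcal{A})^* )^*$ such that for every $a\in\mathcal{A}$: (i) $a\cdot m_\alpha-m_\alpha\cdot a\to0$ in the $wk^*$-topology of $(\sigma wc(\mathcal{A}\hat\otimes\mathcal{A})^* )^*$; (ii) $a\,\pi_{\sigma wc}(m_\alpha)=\pi_{\sigma wc}(m_\alpha)\,a$ for all $\alpha$, and $a\,\pi_{\sigma wc}(m_\alpha)\to a$ in the $wk^*$-topology of $\mathcal{A}$. $\mathcal{A}$ is pseudo-Connes amenable if there is a (not necessarily bounded) net $(m_\alpha)$ in $\mathcal{A}\hat\otimes\mathcal{A}$ (regarded in $(\sigma wc(\mathcal{A}\hat\otimes\mathcal{A})^* )^*$ by evaluation) such that for every $a\in\mathcal{A}$, $a\cdot m_\alpha-m_\alpha\cdot a\to0$ in the $wk^*$-topology of $(\sigma wc(\mathcal{A}\hat\otimes\mathcal{A})^* )^*$ and $a\,\pi_{\sigma wc}(m_\alpha)\to a$ in the $wk^*$-topology of $\mathcal{A}$. *)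

theory Defs
  imports "HOL-Analysis.Analysis" "HOL-Library.Poly_Mapping"
begin

section \<open>Complex normed spaces and Banach algebras\<close>

class complex_normed_vector = real_normed_vector +
  fixes scaleC :: "complex \<Rightarrow> 'a \<Rightarrow> 'a" (infixr "*\<^sub>C" 75)
  assumes scaleC_add_right: "c *\<^sub>C (x + y) = c *\<^sub>C x + c *\<^sub>C y"
    and scaleC_add_left: "(c + d) *\<^sub>C x = c *\<^sub>C x + d *\<^sub>C x"
    and scaleC_scaleC: "c *\<^sub>C (d *\<^sub>C x) = (c * d) *\<^sub>C x"
    and scaleC_of_real: "complex_of_real r *\<^sub>C x = r *\<^sub>R x"
    and norm_scaleC: "norm (c *\<^sub>C x) = cmod c * norm x"

lemma scaleC_one [simp]: "1 *\<^sub>C x = (x::'a::complex_normed_vector)"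
  using scaleC_of_real[of 1 x] by simp

lemma scaleC_zero_left [simp]: "0 *\<^sub>C x = (0::'a::complex_normed_vector)"
  using scaleC_of_real[of 0 x] by simp

lemma scaleC_zero_right [simp]: "c *\<^sub>C 0 = (0::'a::complex_normed_vector)"
  using scaleC_add_right[of c "0::'a" 0] by simp

lemma scaleC_minus_one: "(- 1) *\<^sub>C x = - (x::'a::complex_normed_vector)"
  using scaleC_of_real[of "-1" x] by simp

class complex_banach_algebra = complex_normed_vector + banach + real_normed_algebra +
  assumes mult_scaleC_left: "(c *\<^sub>C x) * y = c *\<^sub>C (x * y)"
    and mult_scaleC_right: "x * (c *\<^sub>C y) = c *\<^sub>C (x * y)"

instantiation complex :: complex_normed_vector
begin
definition scaleC_complex :: "complex \<Rightarrow> complex \<Rightarrow> complex" where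
  "scaleC_complex c x = c * x"
instance
  by standard (simp_all add: scaleC_complex_def algebra_simps norm_mult scaleR_conv_of_real)
end

definition bounded_clinear :: "('a::complex_normed_vector \<Rightarrow> 'b::complex_normed_vector) \<Rightarrow> bool" where
  "bounded_clinear f \<longleftrightarrow> bounded_linear f \<and> (\<forall>c x. f (c *\<^sub>C x) = c *\<^sub>C f x)"

definition bounded_cbilinear ::
    "('a::complex_normed_vector \<Rightarrow> 'b::complex_normed_vector \<Rightarrow> 'c::complex_normed_vector) \<Rightarrow> bool" where
  "bounded_cbilinear B \<longleftrightarrow> bounded_bilinear B \<and>
     (\<forall>c x y. B (c *\<^sub>C x) y = c *\<^sub>C B x y) \<and> (\<forall>c x y. B x (c *\<^sub>C y) = c *\<^sub>C B x y)"

lemma bounded_linear_scaleC: "bounded_linear (\<lambda>x::'a::complex_normed_vector. c *\<^sub>C x)"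
proof (rule bounded_linear_intro[where K="cmod c"])
  fix r and x :: 'a
  show "c *\<^sub>C (r *\<^sub>R x) = r *\<^sub>R (c *\<^sub>C x)"
    by (simp flip: scaleC_of_real add: scaleC_scaleC mult.commute)
qed (simp_all add: scaleC_add_right norm_scaleC mult.commute)

lemma bounded_bilinear_scaleC:
  "bounded_bilinear (scaleC :: complex \<Rightarrow> 'a \<Rightarrow> 'a::complex_normed_vector)"
proof (rule bounded_bilinear.intro)
  fix r c and x :: 'a
  show "(r *\<^sub>R c) *\<^sub>C x = r *\<^sub>R (c *\<^sub>C x)"
    by (simp add: scaleC_scaleC scaleR_conv_of_real scaleC_of_real[symmetric, of r "c *\<^sub>C x"])
  show "c *\<^sub>C (r *\<^sub>R x) = r *\<^sub>R (c *\<^sub>C x)"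
    by (simp flip: scaleC_of_real add: scaleC_scaleC mult.commute)
next
  show "\<exists>K. \<forall>a (b::'a). norm (a *\<^sub>C b) \<le> norm a * norm b * K"
    by (intro exI[of _ 1]) (simp add: norm_scaleC)
qed (simp_all add: scaleC_add_right scaleC_add_left)

instantiation blinfun :: (real_normed_vector, complex_normed_vector) complex_normed_vector
begin
lift_definition scaleC_blinfun :: "complex \<Rightarrow> 'a \<Rightarrow>\<^sub>L 'b \<Rightarrow> 'a \<Rightarrow>\<^sub>L 'b" is "\<lambda>c f x. c *\<^sub>C f x"
  by (rule bounded_linear_compose[OF bounded_linear_scaleC])
instance
proof
  fix c and f :: "'a \<Rightarrow>\<^sub>L 'b"
  have le: "norm (c *\<^sub>C f) \<le> cmod c * norm f" for c and f :: "'a \<Rightarrow>\<^sub>L 'b"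
  proof (rule norm_blinfun_bound)
    fix x
    have "cmod c * norm (blinfun_apply f x) \<le> cmod c * (norm f * norm x)"
      by (intro mult_left_mono norm_blinfun) auto
    then show "norm (blinfun_apply (c *\<^sub>C f) x) \<le> cmod c * norm f * norm x"
      by (simp add: scaleC_blinfun.rep_eq norm_scaleC mult.assoc)
  qed simp
  show "norm (c *\<^sub>C f) = cmod c * norm f"
  proof (cases "c = 0")
    case True
    then show ?thesis using le[of 0 f] by simp
  next
    case False
    have "inverse c *\<^sub>C (c *\<^sub>C f) = f"
      by (rule blinfun_eqI) (simp add: scaleC_blinfun.rep_eq scaleC_scaleC False)
    then have "norm f \<le> cmod (inverse c) * norm (c *\<^sub>C f)"
      using le[of "inverse c" "c *\<^sub>C f"] by simp
    then have "cmod c * norm f \<le> norm (c *\<^sub>C f)"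
      using False by (simp add: norm_inverse norm_divide field_simps)
    with le[of c f] show ?thesis by simp
  qed
qed (rule blinfun_eqI, simp add: scaleC_blinfun.rep_eq blinfun.bilinear_simps
      scaleC_add_right scaleC_add_left scaleC_scaleC scaleC_of_real)+
end

section \<open>The projective tensor product\<close>

text \<open>
  The algebraic tensor product is the free complex vector space on pairs modulo the bilinearity
  relations \<open>tensor_null\<close>. The projective norm is carried along as a seminorm on the free
  space, and the quotient by \<open>tensor_null\<close> and the completion are taken in one step,
  by identifying Cauchy sequences at distance tending to zero.
\<close>

type_synonym ('a, 'b) pre_tensor = "('a \<times> 'b) \<Rightarrow>\<^sub>0 complex"

definition pre_scale :: "complex \<Rightarrow> ('a, 'b) pre_tensor \<Rightarrow> ('a, 'b) pre_tensor" where
  "pre_scale c u = Poly_Mapping.map ((*) c) u"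

definition pre_elem :: "'a \<Rightarrow> 'b \<Rightarrow> ('a, 'b) pre_tensor" where
  "pre_elem a b = Poly_Mapping.single (a, b) 1"

inductive tensor_null :: "('a::complex_normed_vector, 'b::complex_normed_vector) pre_tensor \<Rightarrow> bool" where
  add_left: "tensor_null (pre_elem (a + a') b - (pre_elem a b + pre_elem a' b))"
| add_right: "tensor_null (pre_elem a (b + b') - (pre_elem a b + pre_elem a b'))"
| scale_left: "tensor_null (pre_elem (c *\<^sub>C a) b - pre_scale c (pre_elem a b))"
| scale_right: "tensor_null (pre_elem a (c *\<^sub>C b) - pre_scale c (pre_elem a b))"
| zero: "tensor_null 0"
| plus: "tensor_null u \<Longrightarrow> tensor_null v \<Longrightarrow> tensor_null (u + v)"
| scale: "tensor_null u \<Longrightarrow> tensor_null (pre_scale c u)"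

definition pre_sum :: "('a \<times> 'b) list \<Rightarrow> ('a, 'b) pre_tensor" where
  "pre_sum xs = (\<Sum>(a, b)\<leftarrow>xs. pre_elem a b)"

definition pre_cost :: "('a::real_normed_vector \<times> 'b::real_normed_vector) list \<Rightarrow> real" where
  "pre_cost xs = (\<Sum>(a, b)\<leftarrow>xs. norm a * norm b)"

definition pre_norm :: "('a::complex_normed_vector, 'b::complex_normed_vector) pre_tensor \<Rightarrow> real" where
  "pre_norm u = Inf {pre_cost xs | xs. tensor_null (u - pre_sum xs)}"

lemma lookup_pre_scale [simp]:
  "Poly_Mapping.lookup (pre_scale c u) k = c * Poly_Mapping.lookup u k"
  by (simp add: pre_scale_def Poly_Mapping.map.rep_eq when_def)

lemma pre_scale_add: "pre_scale c (u + v) = pre_scale c u + pre_scale c v"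
  by (rule poly_mapping_eqI) (simp add: lookup_add algebra_simps)

lemma pre_scale_diff: "pre_scale c (u - v) = pre_scale c u - pre_scale c v"
  by (rule poly_mapping_eqI) (simp add: lookup_minus algebra_simps)

lemma pre_scale_add_left: "pre_scale (c + d) u = pre_scale c u + pre_scale d u"
  by (rule poly_mapping_eqI) (simp add: lookup_add algebra_simps)

lemma pre_scale_pre_scale: "pre_scale c (pre_scale d u) = pre_scale (c * d) u"
  by (rule poly_mapping_eqI) simp

lemma pre_scale_one [simp]: "pre_scale 1 u = u"
  by (rule poly_mapping_eqI) simp

lemma pre_scale_0 [simp]: "pre_scale c 0 = 0" "pre_scale 0 u = 0"
  by (rule poly_mapping_eqI, simp)+

lemma pre_scale_minus_one: "pre_scale (- 1) u = - u"
  by (rule poly_mapping_eqI) simp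

lemma pre_sum_simps [simp]:
  "pre_sum [] = 0" "pre_sum ((a, b) # xs) = pre_elem a b + pre_sum xs"
  "pre_sum (xs @ ys) = pre_sum xs + pre_sum ys"
  by (simp_all add: pre_sum_def)

lemma pre_cost_simps [simp]:
  "pre_cost [] = 0" "pre_cost ((a, b) # xs) = norm a * norm b + pre_cost xs"
  "pre_cost (xs @ ys) = pre_cost xs + pre_cost ys"
  by (simp_all add: pre_cost_def)

lemma pre_cost_nonneg [simp]: "0 \<le> pre_cost xs"
  by (induction xs) auto

lemma pre_sum_scale:
  "tensor_null (pre_scale c (pre_sum xs) - pre_sum (map (\<lambda>(a, b). (c *\<^sub>C a, b)) xs))"
proof (induction xs)
  case (Cons x xs)
  obtain a b where x: "x = (a, b)" by fastforce
  have "tensor_null (pre_scale (- 1) (pre_elem (c *\<^sub>C a) b - pre_scale c (pre_elem a b)))"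
    by (intro tensor_null.intros)
  from tensor_null.plus[OF this Cons] show ?case
    by (simp add: x pre_scale_add pre_scale_minus_one algebra_simps)
qed (simp add: tensor_null.zero)

lemma pre_cost_scale: "pre_cost (map (\<lambda>(a, b). (c *\<^sub>C a, b)) xs) = cmod c * pre_cost xs"
  by (induction xs) (auto simp: norm_scaleC algebra_simps)

lemma pre_sum_exists: "\<exists>xs. tensor_null (u - pre_sum xs)"
proof (induction u rule: update_induct)
  case const
  show ?case by (intro exI[of _ "[]"]) (simp add: tensor_null.zero)
next
  case (update f k v)
  obtain a b where k: "k = (a, b)" by fastforce
  have eq: "Poly_Mapping.update k v f = f + pre_scale v (pre_elem a b)"
    using update(1)
    by (intro poly_mapping_eqI)
       (auto simp: pre_elem_def k lookup_single when_def lookup_add lookup_update in_keys_iff)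
  from update obtain xs where xs: "tensor_null (f - pre_sum xs)" by blast
  have "tensor_null (pre_scale v (pre_elem a b) - pre_elem (v *\<^sub>C a) b)"
    using pre_sum_scale[of v "[(a, b)]"] by simp
  from tensor_null.plus[OF xs this] show ?case
    by (intro exI[of _ "xs @ [(v *\<^sub>C a, b)]"]) (simp add: eq algebra_simps)
qed

lemma pre_norm_le: "tensor_null (u - pre_sum xs) \<Longrightarrow> pre_norm u \<le> pre_cost xs"
  unfolding pre_norm_def by (intro cInf_lower) (auto intro!: bdd_belowI[of _ 0])

lemma pre_norm_nonneg [simp]: "0 \<le> pre_norm u"
  unfolding pre_norm_def using pre_sum_exists[of u] by (intro cInf_greatest) auto

lemma pre_norm_approx:
  assumes "0 < e" obtains xs where "tensor_null (u - pre_sum xs)" "pre_cost xs < pre_norm u + e"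
proof -
  have "{pre_cost xs | xs. tensor_null (u - pre_sum xs)} \<noteq> {}"
    using pre_sum_exists[of u] by auto
  from cInf_lessD[OF this, of "pre_norm u + e"] assms show ?thesis
    by (auto simp: pre_norm_def intro: that)
qed

lemma pre_norm_0 [simp]: "pre_norm (0 :: ('a::complex_normed_vector, 'b::complex_normed_vector) pre_tensor) = 0"
proof (rule antisym)
  show "pre_norm (0 :: ('a, 'b) pre_tensor) \<le> 0"
    using pre_norm_le[of 0 "[]"] tensor_null.zero by simp
qed simp

lemma pre_norm_triangle: "pre_norm (u + v) \<le> pre_norm u + pre_norm v"
proof (rule field_le_epsilon)
  fix e :: real assume e: "0 < e"
  obtain xs where xs: "tensor_null (u - pre_sum xs)" "pre_cost xs < pre_norm u + e/2"
    using pre_norm_approx[of "e/2" u] e by auto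
  obtain ys where ys: "tensor_null (v - pre_sum ys)" "pre_cost ys < pre_norm v + e/2"
    using pre_norm_approx[of "e/2" v] e by auto
  have "pre_norm (u + v) \<le> pre_cost (xs @ ys)"
    using tensor_null.plus[OF xs(1) ys(1)] by (intro pre_norm_le) (simp add: algebra_simps)
  then show "pre_norm (u + v) \<le> pre_norm u + pre_norm v + e" using xs ys by simp
qed

lemma pre_norm_scale_le: "pre_norm (pre_scale c u) \<le> cmod c * pre_norm u"
proof (rule field_le_epsilon)
  fix e :: real assume e: "0 < e"
  have pos: "0 < e / (cmod c + 1)" using e by (simp add: add_nonneg_pos)
  obtain xs where xs: "tensor_null (u - pre_sum xs)" "pre_cost xs < pre_norm u + e / (cmod c + 1)"
    using pre_norm_approx[OF pos] by metis
  have "pre_norm (pre_scale c u) \<le> pre_cost (map (\<lambda>(a, b). (c *\<^sub>C a, b)) xs)"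
    using tensor_null.plus[OF tensor_null.scale[OF xs(1), of c] pre_sum_scale[of c xs]]
    by (intro pre_norm_le) (simp add: pre_scale_diff)
  also have "\<dots> \<le> cmod c * (pre_norm u + e / (cmod c + 1))"
    unfolding pre_cost_scale using xs(2) by (intro mult_left_mono) auto
  also have "\<dots> = cmod c * pre_norm u + e * (cmod c / (cmod c + 1))" by (simp add: algebra_simps)
  also have "\<dots> \<le> cmod c * pre_norm u + e * 1"
    using e by (intro add_left_mono mult_left_mono) (auto simp: divide_le_eq_1 add_nonneg_pos)
  finally show "pre_norm (pre_scale c u) \<le> cmod c * pre_norm u + e" by simp
qed

lemma pre_norm_scale: "pre_norm (pre_scale c u) = cmod c * pre_norm u"
proof (cases "c = 0")
  case False
  have "pre_norm u \<le> cmod (inverse c) * pre_norm (pre_scale c u)"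
    using pre_norm_scale_le[of "inverse c" "pre_scale c u"] False by (simp add: pre_scale_pre_scale)
  then have "cmod c * pre_norm u \<le> pre_norm (pre_scale c u)"
    using False by (simp add: norm_inverse norm_divide field_simps)
  with pre_norm_scale_le[of c u] show ?thesis by simp
qed simp

lemma pre_norm_minus: "pre_norm (- u) = pre_norm u"
  using pre_norm_scale[of "-1" u] by (simp add: pre_scale_minus_one)

lemma pre_norm_minus_commute: "pre_norm (u - v) = pre_norm (v - u)"
  using pre_norm_minus[of "u - v"] by simp

lemma pre_norm_diff: "\<bar>pre_norm u - pre_norm v\<bar> \<le> pre_norm (u - v)"
  using pre_norm_triangle[of "u - v" v] pre_norm_triangle[of "v - u" u] pre_norm_minus_commute[of u v]
  by simp

lemma pre_norm_triangle4: "pre_norm ((u + v) - (u' + v')) \<le> pre_norm (u - u') + pre_norm (v - v')"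
  using pre_norm_triangle[of "u - u'" "v - v'"] by (simp add: algebra_simps)

lemma pre_norm_triangle3: "pre_norm (u - w) \<le> pre_norm (u - v) + pre_norm (v - w)"
  using pre_norm_triangle[of "u - v" "v - w"] by simp

definition pre_Cauchy :: "(nat \<Rightarrow> ('a::complex_normed_vector, 'b::complex_normed_vector) pre_tensor) \<Rightarrow> bool" where
  "pre_Cauchy X \<longleftrightarrow> (\<forall>e>0. \<exists>N. \<forall>m\<ge>N. \<forall>n\<ge>N. pre_norm (X m - X n) < e)"

definition pre_rel :: "(nat \<Rightarrow> ('a::complex_normed_vector, 'b::complex_normed_vector) pre_tensor) \<Rightarrow>
    (nat \<Rightarrow> ('a, 'b) pre_tensor) \<Rightarrow> bool" where
  "pre_rel X Y \<longleftrightarrow> pre_Cauchy X \<and> pre_Cauchy Y \<and> (\<lambda>n. pre_norm (X n - Y n)) \<longlonglongrightarrow> 0"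

lemma pre_Cauchy_const [simp]: "pre_Cauchy (\<lambda>n. u)"
  by (simp add: pre_Cauchy_def)

lemma pre_rel_refl_iff: "pre_rel X X \<longleftrightarrow> pre_Cauchy X"
  by (simp add: pre_rel_def)

lemma pre_Cauchy_add:
  assumes "pre_Cauchy X" "pre_Cauchy Y" shows "pre_Cauchy (\<lambda>n. X n + Y n)"
  unfolding pre_Cauchy_def
proof (intro allI impI)
  fix e :: real assume "0 < e"
  then have "0 < e/2" by simp
  with assms obtain M N where "\<forall>m\<ge>M. \<forall>n\<ge>M. pre_norm (X m - X n) < e/2"
      "\<forall>m\<ge>N. \<forall>n\<ge>N. pre_norm (Y m - Y n) < e/2"
    unfolding pre_Cauchy_def by meson
  then have "pre_norm ((X m + Y m) - (X n + Y n)) < e" if "m \<ge> max M N" "n \<ge> max M N" for m n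
    using that pre_norm_triangle4[of "X m" "Y m" "X n" "Y n"]
      add_strict_mono[of "pre_norm (X m - X n)" "e/2" "pre_norm (Y m - Y n)" "e/2"] by simp
  then show "\<exists>N. \<forall>m\<ge>N. \<forall>n\<ge>N. pre_norm ((X m + Y m) - (X n + Y n)) < e" by blast
qed

lemma pre_Cauchy_scale:
  assumes "pre_Cauchy X" shows "pre_Cauchy (\<lambda>n. pre_scale c (X n))"
  unfolding pre_Cauchy_def
proof (intro allI impI)
  fix e :: real assume e: "0 < e"
  then have "0 < e / (cmod c + 1)" by (simp add: add_nonneg_pos)
  with assms obtain N where N: "\<forall>m\<ge>N. \<forall>n\<ge>N. pre_norm (X m - X n) < e / (cmod c + 1)"
    unfolding pre_Cauchy_def by meson
  have "pre_norm (pre_scale c (X m) - pre_scale c (X n)) < e" if "m \<ge> N" "n \<ge> N" for m n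
  proof -
    have "cmod c * pre_norm (X m - X n) \<le> (cmod c + 1) * pre_norm (X m - X n)"
      by (intro mult_right_mono) auto
    also have "\<dots> < e" using N that by (simp add: less_divide_eq add_nonneg_pos mult.commute)
    finally show ?thesis by (simp add: pre_norm_scale flip: pre_scale_diff)
  qed
  then show "\<exists>N. \<forall>m\<ge>N. \<forall>n\<ge>N. pre_norm (pre_scale c (X m) - pre_scale c (X n)) < e" by blast
qed

lemma pre_norm_convergent: assumes "pre_Cauchy X" shows "convergent (\<lambda>n. pre_norm (X n))"
proof -
  have "Cauchy (\<lambda>n. pre_norm (X n))"
    using assms unfolding Cauchy_def pre_Cauchy_def dist_real_def
    by (meson pre_norm_diff le_less_trans)
  then show ?thesis by (simp add: Cauchy_convergent_iff)
qed

lemma pre_rel_part_equivp: "part_equivp pre_rel"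
proof (rule part_equivpI)
  show "\<exists>x. pre_rel x x" by (rule exI[of _ "\<lambda>n. 0"]) (simp add: pre_rel_def)
  show "symp pre_rel" by (auto intro!: sympI simp: pre_rel_def pre_norm_minus_commute)
  show "transp pre_rel"
  proof (rule transpI)
    fix X Y Z assume *: "pre_rel X Y" "pre_rel Y Z"
    have lim: "(\<lambda>n. pre_norm (X n - Y n) + pre_norm (Y n - Z n)) \<longlonglongrightarrow> 0"
      using tendsto_add[of "\<lambda>n. pre_norm (X n - Y n)" 0 sequentially "\<lambda>n. pre_norm (Y n - Z n)" 0] *
      unfolding pre_rel_def by simp
    have "(\<lambda>n. pre_norm (X n - Z n)) \<longlonglongrightarrow> 0"
      by (rule Lim_null_comparison[OF _ lim]) (simp add: pre_norm_triangle3)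
    then show "pre_rel X Z" using * by (simp add: pre_rel_def)
  qed
qed

quotient_type (overloaded) ('a, 'b) ptensor =
  "nat \<Rightarrow> ('a::complex_normed_vector, 'b::complex_normed_vector) pre_tensor" / partial: pre_rel
  by (rule pre_rel_part_equivp)


instantiation ptensor :: (complex_normed_vector, complex_normed_vector) complex_normed_vector
begin

lift_definition zero_ptensor :: "('a, 'b) ptensor" is "\<lambda>n. 0"
  by (simp add: pre_rel_refl_iff)

lift_definition plus_ptensor :: "('a, 'b) ptensor \<Rightarrow> ('a, 'b) ptensor \<Rightarrow> ('a, 'b) ptensor"
  is "\<lambda>X Y n. X n + Y n"
proof -
  fix X X' Y Y' :: "nat \<Rightarrow> ('a, 'b) pre_tensor"
  assume *: "pre_rel X X'" "pre_rel Y Y'"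
  have lim: "(\<lambda>n. pre_norm (X n - X' n) + pre_norm (Y n - Y' n)) \<longlonglongrightarrow> 0"
    using tendsto_add[of "\<lambda>n. pre_norm (X n - X' n)" 0 sequentially "\<lambda>n. pre_norm (Y n - Y' n)" 0] *
    unfolding pre_rel_def by simp
  have "(\<lambda>n. pre_norm ((X n + Y n) - (X' n + Y' n))) \<longlonglongrightarrow> 0"
    by (rule Lim_null_comparison[OF _ lim]) (simp add: pre_norm_triangle4)
  then show "pre_rel (\<lambda>n. X n + Y n) (\<lambda>n. X' n + Y' n)"
    using * by (simp add: pre_rel_def pre_Cauchy_add)
qed

lift_definition scaleC_ptensor :: "complex \<Rightarrow> ('a, 'b) ptensor \<Rightarrow> ('a, 'b) ptensor"
  is "\<lambda>c X n. pre_scale c (X n)"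
proof -
  fix c and X Y :: "nat \<Rightarrow> ('a, 'b) pre_tensor"
  assume *: "pre_rel X Y"
  then have "(\<lambda>n. cmod c * pre_norm (X n - Y n)) \<longlonglongrightarrow> 0"
    using tendsto_mult_right_zero unfolding pre_rel_def by blast
  then show "pre_rel (\<lambda>n. pre_scale c (X n)) (\<lambda>n. pre_scale c (Y n))"
    using * by (simp add: pre_rel_def pre_Cauchy_scale pre_norm_scale flip: pre_scale_diff)
qed

lift_definition norm_ptensor :: "('a, 'b) ptensor \<Rightarrow> real" is "\<lambda>X. lim (\<lambda>n. pre_norm (X n))"
proof -
  fix X Y :: "nat \<Rightarrow> ('a, 'b) pre_tensor"
  assume *: "pre_rel X Y"
  then have lim: "(\<lambda>n. pre_norm (X n - Y n)) \<longlonglongrightarrow> 0" by (simp add: pre_rel_def)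
  have d: "(\<lambda>n. pre_norm (X n) - pre_norm (Y n)) \<longlonglongrightarrow> 0"
    by (rule Lim_null_comparison[OF _ lim]) (simp add: pre_norm_diff)
  have "(\<lambda>n. pre_norm (X n)) \<longlonglongrightarrow> lim (\<lambda>n. pre_norm (X n))"
      "(\<lambda>n. pre_norm (Y n)) \<longlonglongrightarrow> lim (\<lambda>n. pre_norm (Y n))"
    using * pre_norm_convergent unfolding pre_rel_def convergent_LIMSEQ_iff by blast+
  from LIMSEQ_unique[OF tendsto_diff[OF this] d]
  show "lim (\<lambda>n. pre_norm (X n)) = lim (\<lambda>n. pre_norm (Y n))" by simp
qed

definition "uminus_ptensor (x :: ('a, 'b) ptensor) = (- 1) *\<^sub>C x"
definition "minus_ptensor (x :: ('a, 'b) ptensor) y = x + (- y)"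
definition "scaleR_ptensor r (x :: ('a, 'b) ptensor) = complex_of_real r *\<^sub>C x"
definition "dist_ptensor (x :: ('a, 'b) ptensor) y = norm (x - y)"
definition "sgn_ptensor (x :: ('a, 'b) ptensor) = inverse (norm x) *\<^sub>R x"
definition "uniformity_ptensor =
  (INF e\<in>{0<..}. principal {(x :: ('a, 'b) ptensor, y). dist x y < e})"
definition "open_ptensor (U :: ('a, 'b) ptensor set) \<longleftrightarrow>
  (\<forall>x\<in>U. \<forall>\<^sub>F (x', y) in uniformity. x' = x \<longrightarrow> y \<in> U)"

lemma norm_ptensor_lim:
  assumes "pre_Cauchy X"
  shows "(\<lambda>n. pre_norm (X n)) \<longlonglongrightarrow> norm (abs_ptensor X)"
  using assms pre_norm_convergent[OF assms]
  by (simp add: norm_ptensor.abs_eq pre_rel_refl_iff convergent_LIMSEQ_iff)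

lemma plus_ptensor_abs:
  "pre_Cauchy X \<Longrightarrow> pre_Cauchy Y \<Longrightarrow> abs_ptensor X + abs_ptensor Y = abs_ptensor (\<lambda>n. X n + Y n)"
  by (simp add: plus_ptensor.abs_eq pre_rel_refl_iff)

lemma scaleC_ptensor_abs:
  "pre_Cauchy X \<Longrightarrow> c *\<^sub>C abs_ptensor X = abs_ptensor (\<lambda>n. pre_scale c (X n))"
  by (simp add: scaleC_ptensor.abs_eq pre_rel_refl_iff)

lemma ptensor_cases: obtains X where "pre_Cauchy (X :: nat \<Rightarrow> ('a, 'b) pre_tensor)" "x = abs_ptensor X"
proof -
  have "pre_rel (rep_ptensor x) (rep_ptensor x)" "abs_ptensor (rep_ptensor x) = x"
    using Quotient3_ptensor by (auto simp: Quotient3_def)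
  then show ?thesis using that[of "rep_ptensor x"] by (simp add: pre_rel_refl_iff)
qed

lemma ptensor_eqI:
  "pre_Cauchy X \<Longrightarrow> pre_Cauchy Y \<Longrightarrow> (\<lambda>n. pre_norm (X n - Y n)) \<longlonglongrightarrow> 0 \<Longrightarrow> abs_ptensor X = abs_ptensor Y"
  using Quotient3_rel_abs[OF Quotient3_ptensor, of X Y] by (simp add: pre_rel_def)

instance
proof
  fix x y z :: "('a, 'b) ptensor" and c d :: complex and r s :: real
  obtain X where X: "pre_Cauchy X" "x = abs_ptensor X" by (rule ptensor_cases)
  obtain Y where Y: "pre_Cauchy Y" "y = abs_ptensor Y" by (rule ptensor_cases)
  obtain Z where Z: "pre_Cauchy Z" "z = abs_ptensor Z" by (rule ptensor_cases)
  note C = X(1) Y(1) Z(1) pre_Cauchy_add pre_Cauchy_scale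
  note S = X(2) Y(2) Z(2) plus_ptensor_abs scaleC_ptensor_abs C zero_ptensor_def
  show "x + y + z = x + (y + z)" by (simp add: S add.assoc)
  show comm: "x + y = y + x" by (simp add: S add.commute)
  show "0 + x = x" by (simp add: S)
  show "x - y = x + - y" by (simp add: minus_ptensor_def)
  show addr: "c *\<^sub>C (x + y) = c *\<^sub>C x + c *\<^sub>C y" by (simp add: S pre_scale_add)
  show addl: "(c + d) *\<^sub>C x = c *\<^sub>C x + d *\<^sub>C x" for c d by (simp add: S pre_scale_add_left)
  have one: "1 *\<^sub>C x = x" and null: "0 *\<^sub>C x = 0" by (simp_all add: S)
  show "- x + x = 0" using addl[of "- 1" 1] by (simp add: uminus_ptensor_def one null)
  show assoc: "c *\<^sub>C d *\<^sub>C x = (c * d) *\<^sub>C x" for c d by (simp add: S pre_scale_pre_scale)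
  show "complex_of_real r *\<^sub>C x = r *\<^sub>R x" by (simp add: scaleR_ptensor_def)
  show "r *\<^sub>R (x + y) = r *\<^sub>R x + r *\<^sub>R y" by (simp add: scaleR_ptensor_def S pre_scale_add)
  show "(r + s) *\<^sub>R x = r *\<^sub>R x + s *\<^sub>R x" by (simp add: scaleR_ptensor_def addl)
  show "r *\<^sub>R s *\<^sub>R x = (r * s) *\<^sub>R x" by (simp add: scaleR_ptensor_def assoc)
  show "1 *\<^sub>R x = x" by (simp add: scaleR_ptensor_def one)
  show nC: "norm (c *\<^sub>C x) = cmod c * norm x" for c
  proof -
    have "(\<lambda>n. pre_norm (pre_scale c (X n))) \<longlonglongrightarrow> norm (c *\<^sub>C x)"
      using norm_ptensor_lim[OF pre_Cauchy_scale[OF X(1), of c]] by (simp add: S)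
    moreover have "(\<lambda>n. pre_norm (pre_scale c (X n))) \<longlonglongrightarrow> cmod c * norm x"
      unfolding pre_norm_scale X(2) by (intro tendsto_mult_left norm_ptensor_lim X)
    ultimately show ?thesis by (rule LIMSEQ_unique)
  qed
  show "norm (r *\<^sub>R x) = \<bar>r\<bar> * norm x" by (simp add: scaleR_ptensor_def nC)
  show "norm (x + y) \<le> norm x + norm y"
  proof (rule LIMSEQ_le)
    show "(\<lambda>n. pre_norm (X n + Y n)) \<longlonglongrightarrow> norm (x + y)"
      using norm_ptensor_lim[OF pre_Cauchy_add[OF X(1) Y(1)]] by (simp add: S)
    show "(\<lambda>n. pre_norm (X n) + pre_norm (Y n)) \<longlonglongrightarrow> norm x + norm y"
      unfolding X(2) Y(2) by (intro tendsto_add norm_ptensor_lim X Y)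
  qed (use pre_norm_triangle in blast)
  show "norm x = 0 \<longleftrightarrow> x = 0"
  proof
    assume "norm x = 0"
    with norm_ptensor_lim[OF X(1)] show "x = 0"
      unfolding X(2) zero_ptensor_def by (intro ptensor_eqI X) (simp_all add: X)
  next
    assume "x = 0"
    then show "norm x = 0"
      using norm_ptensor_lim[of "\<lambda>n. 0 :: ('a, 'b) pre_tensor"]
      by (simp add: zero_ptensor_def LIMSEQ_const_iff)
  qed
qed (rule dist_ptensor_def sgn_ptensor_def uniformity_ptensor_def open_ptensor_def)+

end

definition pre_embed ::
    "('a::complex_normed_vector, 'b::complex_normed_vector) pre_tensor \<Rightarrow> ('a, 'b) ptensor" where
  "pre_embed u = abs_ptensor (\<lambda>n. u)"

definition tensor :: "'a::complex_normed_vector \<Rightarrow> 'b::complex_normed_vector \<Rightarrow> ('a, 'b) ptensor"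
    (infixl "\<otimes>\<^sub>\<pi>" 70) where
  "a \<otimes>\<^sub>\<pi> b = pre_embed (pre_elem a b)"

lemma norm_pre_embed: "norm (pre_embed u) = pre_norm u"
  using norm_ptensor_lim[of "\<lambda>n. u"] by (simp add: pre_embed_def LIMSEQ_const_iff)

lemma pre_embed_add: "pre_embed (u + v) = pre_embed u + pre_embed v"
  by (simp add: pre_embed_def plus_ptensor_abs)

lemma pre_embed_scale: "pre_embed (pre_scale c u) = c *\<^sub>C pre_embed u"
  by (simp add: pre_embed_def scaleC_ptensor_abs)

lemma pre_embed_zero: "pre_embed 0 = 0"
  by (simp add: pre_embed_def zero_ptensor_def)

lemma pre_embed_diff: "pre_embed (u - v) = pre_embed u - pre_embed v"
  using pre_embed_add[of u "- v"] pre_embed_scale[of "- 1" v]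
  by (simp add: scaleC_minus_one pre_scale_minus_one)

lemma pre_embed_tendsto:
  assumes "pre_Cauchy X" shows "(\<lambda>n. pre_embed (X n)) \<longlonglongrightarrow> abs_ptensor X"
proof (rule LIMSEQ_I)
  fix e :: real assume "0 < e"
  then have "0 < e/2" by simp
  then obtain N where N: "\<forall>m\<ge>N. \<forall>n\<ge>N. pre_norm (X m - X n) < e/2"
    using assms unfolding pre_Cauchy_def by meson
  have "norm (pre_embed (X n) - abs_ptensor X) < e" if n: "n \<ge> N" for n
  proof -
    have C: "pre_Cauchy (\<lambda>m. X m + - X n)" 
      by (intro pre_Cauchy_add assms pre_Cauchy_const)
    have "abs_ptensor X - pre_embed (X n) = abs_ptensor (\<lambda>m. X m + - X n)"
      using assms plus_ptensor_abs[OF assms pre_Cauchy_const[of "- X n"]]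
      by (simp add: pre_embed_def minus_ptensor_def uminus_ptensor_def scaleC_ptensor_abs pre_scale_minus_one)
    then have "(\<lambda>m. pre_norm (X m + - X n)) \<longlonglongrightarrow> norm (abs_ptensor X - pre_embed (X n))"
      using norm_ptensor_lim[OF C] by simp
    then have "norm (abs_ptensor X - pre_embed (X n)) \<le> e/2"
      by (rule LIMSEQ_le_const2) (use N n in \<open>auto intro!: exI[of _ N] less_imp_le\<close>)
    then show ?thesis using \<open>0 < e\<close> by (simp add: norm_minus_commute)
  qed
  then show "\<exists>N. \<forall>n\<ge>N. norm (pre_embed (X n) - abs_ptensor X) < e" by blast
qed

lemma pre_embed_dense:
  fixes x :: "('a::complex_normed_vector, 'b::complex_normed_vector) ptensor"
  assumes "0 < e" obtains u where "norm (x - pre_embed u) < e"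
proof -
  obtain X where X: "pre_Cauchy X" "x = abs_ptensor X" by (rule ptensor_cases)
  from LIMSEQ_D[OF pre_embed_tendsto[OF X(1)] assms] obtain N where
    "\<forall>n\<ge>N. norm (pre_embed (X n) - abs_ptensor X) < e" by blast
  then show ?thesis using that[of "X N"] X(2) by (simp add: norm_minus_commute)
qed

instance ptensor :: (complex_normed_vector, complex_normed_vector) banach
proof
  fix X :: "nat \<Rightarrow> ('a, 'b) ptensor"
  assume X: "Cauchy X"
  have "\<exists>u. norm (X n - pre_embed u) < inverse (real (Suc n))" for n
    by (rule pre_embed_dense[of "inverse (real (Suc n))" "X n"]) (simp, blast)
  then obtain Y where Y: "\<And>n. norm (X n - pre_embed (Y n)) < inverse (real (Suc n))" by metis
  have diff: "(\<lambda>n. X n - pre_embed (Y n)) \<longlonglongrightarrow> 0"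
    by (rule Lim_null_comparison[OF _ LIMSEQ_inverse_real_of_nat])
       (intro always_eventually allI less_imp_le Y)
  have "pre_Cauchy Y"
    unfolding pre_Cauchy_def
  proof (intro allI impI)
    fix e :: real assume "0 < e"
    then have e: "0 < e/3" by simp
    from X e obtain M where M: "\<forall>m\<ge>M. \<forall>n\<ge>M. norm (X m - X n) < e/3"
      unfolding Cauchy_iff by blast
    from LIMSEQ_D[OF diff e] obtain N where N: "\<forall>n\<ge>N. norm (X n - pre_embed (Y n)) < e/3"
      by auto
    have "pre_norm (Y m - Y n) < e" if mn: "m \<ge> max M N" "n \<ge> max M N" for m n
    proof -
      have eq: "pre_embed (Y m) - pre_embed (Y n) =
          ((X m - X n) - (X m - pre_embed (Y m))) + (X n - pre_embed (Y n))" by simp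
      have "pre_norm (Y m - Y n) = norm (pre_embed (Y m) - pre_embed (Y n))"
        by (simp only: norm_pre_embed flip: pre_embed_diff)
      also have "\<dots> \<le> norm ((X m - X n) - (X m - pre_embed (Y m))) + norm (X n - pre_embed (Y n))"
        unfolding eq by (rule norm_triangle_ineq)
      also have "\<dots> \<le> norm (X m - X n) + norm (X m - pre_embed (Y m)) + norm (X n - pre_embed (Y n))"
        by (intro add_right_mono norm_triangle_ineq4)
      finally have "pre_norm (Y m - Y n) \<le>
          norm (X m - X n) + norm (X m - pre_embed (Y m)) + norm (X n - pre_embed (Y n))" .
      moreover have "norm (X m - X n) < e/3" "norm (X m - pre_embed (Y m)) < e/3"
          "norm (X n - pre_embed (Y n)) < e/3" using M N mn by auto
      ultimately show ?thesis by linarith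
    qed
    then show "\<exists>N. \<forall>m\<ge>N. \<forall>n\<ge>N. pre_norm (Y m - Y n) < e" by blast
  qed
  from tendsto_add[OF pre_embed_tendsto[OF this] diff] show "convergent X"
    by (auto simp: convergent_def)
qed

lemma pre_embed_null: assumes "tensor_null w" shows "pre_embed w = 0"
proof -
  have "pre_norm w \<le> 0" using pre_norm_le[of w "[]"] assms by simp
  then have "norm (pre_embed w) = 0" using pre_norm_nonneg[of w] unfolding norm_pre_embed by linarith
  then show ?thesis by simp
qed

lemma norm_tensor_le: "norm (a \<otimes>\<^sub>\<pi> b) \<le> norm a * norm b"
  using pre_norm_le[of "pre_elem a b" "[(a, b)]"] tensor_null.zero
  by (simp add: tensor_def norm_pre_embed)

lemma tensor_add_left: "(a + a') \<otimes>\<^sub>\<pi> b = a \<otimes>\<^sub>\<pi> b + a' \<otimes>\<^sub>\<pi> b"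
  using pre_embed_null[OF tensor_null.add_left[of a a' b]]
  by (simp add: tensor_def pre_embed_diff pre_embed_add)

lemma tensor_add_right: "a \<otimes>\<^sub>\<pi> (b + b') = a \<otimes>\<^sub>\<pi> b + a \<otimes>\<^sub>\<pi> b'"
  using pre_embed_null[OF tensor_null.add_right[of a b b']]
  by (simp add: tensor_def pre_embed_diff pre_embed_add)

lemma tensor_scaleC_left: "(c *\<^sub>C a) \<otimes>\<^sub>\<pi> b = c *\<^sub>C (a \<otimes>\<^sub>\<pi> b)"
  using pre_embed_null[OF tensor_null.scale_left[of c a b]]
  by (simp add: tensor_def pre_embed_diff pre_embed_scale)

lemma tensor_scaleC_right: "a \<otimes>\<^sub>\<pi> (c *\<^sub>C b) = c *\<^sub>C (a \<otimes>\<^sub>\<pi> b)"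
  using pre_embed_null[OF tensor_null.scale_right[of a c b]]
  by (simp add: tensor_def pre_embed_diff pre_embed_scale)

lemma bounded_cbilinear_tensor: "bounded_cbilinear (\<otimes>\<^sub>\<pi>)"
  unfolding bounded_cbilinear_def
proof (intro conjI allI bounded_bilinear.intro)
  show "\<exists>K. \<forall>(a::'a) (b::'b). norm (a \<otimes>\<^sub>\<pi> b) \<le> norm a * norm b * K"
    by (intro exI[of _ 1]) (simp add: norm_tensor_le)
qed (simp_all add: tensor_add_left tensor_add_right tensor_scaleC_left tensor_scaleC_right
      flip: scaleC_of_real)

lemma clinear_eq_0_on_tensors:
  fixes T :: "('a::complex_normed_vector, 'b::complex_normed_vector) ptensor \<Rightarrow> 'c::complex_normed_vector"
  assumes T: "bounded_clinear T" "\<And>a b. T (a \<otimes>\<^sub>\<pi> b) = 0"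
  shows "T x = 0"
proof -
  have lin: "bounded_linear T" and sc: "\<And>c x. T (c *\<^sub>C x) = c *\<^sub>C T x"
    using T(1) by (auto simp: bounded_clinear_def)
  have emb: "T (pre_embed u) = 0" for u
  proof (induction u rule: update_induct)
    case const
    show ?case using linear_0[OF bounded_linear.linear[OF lin]] by (simp add: pre_embed_zero)
  next
    case (update f k v)
    obtain a b where k: "k = (a, b)" by fastforce
    have eq: "Poly_Mapping.update k v f = f + pre_scale v (pre_elem a b)"
      using update(1)
      by (intro poly_mapping_eqI)
         (auto simp: pre_elem_def k lookup_single when_def lookup_add lookup_update in_keys_iff)
    have "T (pre_embed (f + pre_scale v (pre_elem a b))) = T (pre_embed f) + v *\<^sub>C T (a \<otimes>\<^sub>\<pi> b)"
      by (simp add: pre_embed_add pre_embed_scale linear_add[OF bounded_linear.linear[OF lin]] sc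
          flip: tensor_def)
    then show ?case by (simp add: eq update T(2))
  qed
  obtain X where X: "pre_Cauchy X" "x = abs_ptensor X" by (rule ptensor_cases)
  have "(\<lambda>n. T (pre_embed (X n))) \<longlonglongrightarrow> T x"
    unfolding X(2) by (rule bounded_linear.tendsto[OF lin pre_embed_tendsto[OF X(1)]])
  then show ?thesis by (simp add: emb LIMSEQ_const_iff)
qed

definition pre_extend ::
    "('a \<Rightarrow> 'b \<Rightarrow> 'c::complex_normed_vector) \<Rightarrow> ('a, 'b) pre_tensor \<Rightarrow> 'c" where
  "pre_extend B u = (\<Sum>k\<in>Poly_Mapping.keys u. Poly_Mapping.lookup u k *\<^sub>C B (fst k) (snd k))"

lemma pre_extend_superset:
  assumes "finite S" "Poly_Mapping.keys u \<subseteq> S"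
  shows "pre_extend B u = (\<Sum>k\<in>S. Poly_Mapping.lookup u k *\<^sub>C B (fst k) (snd k))"
  unfolding pre_extend_def using assms by (intro sum.mono_neutral_left) (auto simp: in_keys_iff)

lemma pre_extend_add: "pre_extend B (u + v) = pre_extend B u + pre_extend B v"
proof -
  let ?S = "Poly_Mapping.keys u \<union> Poly_Mapping.keys v"
  have S: "finite ?S" "Poly_Mapping.keys u \<subseteq> ?S" "Poly_Mapping.keys v \<subseteq> ?S"
    "Poly_Mapping.keys (u + v) \<subseteq> ?S" by (auto dest: subsetD[OF keys_add])
  show ?thesis
    unfolding pre_extend_superset[OF S(1,2)] pre_extend_superset[OF S(1,3)]
      pre_extend_superset[OF S(1,4)]
    by (simp add: lookup_add scaleC_add_left sum.distrib)
qed

lemma scaleC_sum_right: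
  "c *\<^sub>C (\<Sum>k\<in>S. f k *\<^sub>C g k) = (\<Sum>k\<in>S. (c * f k) *\<^sub>C (g k :: 'c::complex_normed_vector))"
  by (induction S rule: infinite_finite_induct) (simp_all add: scaleC_add_right scaleC_scaleC)

lemma pre_extend_scale: "pre_extend B (pre_scale c u) = c *\<^sub>C pre_extend B u"
proof -
  have S: "finite (Poly_Mapping.keys u)" "Poly_Mapping.keys (pre_scale c u) \<subseteq> Poly_Mapping.keys u"
    by (auto simp: in_keys_iff)
  show ?thesis
    unfolding pre_extend_superset[OF S] by (simp add: pre_extend_def scaleC_sum_right)
qed

lemma pre_extend_diff: "pre_extend B (u - v) = pre_extend B u - pre_extend B v"
  using pre_extend_add[of B u "- v"] pre_extend_scale[of B "- 1" v]
  by (simp add: scaleC_minus_one pre_scale_minus_one)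

lemma pre_extend_elem [simp]: "pre_extend B (pre_elem a b) = B a b"
  by (simp add: pre_extend_def pre_elem_def)

lemma pre_extend_0 [simp]: "pre_extend B 0 = 0"
  by (simp add: pre_extend_def)

lemma pre_extend_null:
  assumes B: "bounded_cbilinear B" and "tensor_null u"
  shows "pre_extend B u = 0"
  using assms(2)
proof induction
  case (add_left a a' b)
  show ?case using B
    by (simp add: pre_extend_diff pre_extend_add bounded_cbilinear_def bounded_bilinear.add_left)
next
  case (add_right a b b')
  show ?case using B
    by (simp add: pre_extend_diff pre_extend_add bounded_cbilinear_def bounded_bilinear.add_right)
next
  case (scale_left c a b)
  show ?case using B by (simp add: pre_extend_diff pre_extend_scale bounded_cbilinear_def)
next
  case (scale_right a c b)
  show ?case using B by (simp add: pre_extend_diff pre_extend_scale bounded_cbilinear_def)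
qed (simp_all add: pre_extend_add pre_extend_scale)

lemma pre_extend_bound:
  fixes B :: "'a::complex_normed_vector \<Rightarrow> 'b::complex_normed_vector \<Rightarrow> 'c::complex_normed_vector"
  assumes B: "bounded_cbilinear B" and K: "0 \<le> K" "\<And>a b. norm (B a b) \<le> norm a * norm b * K"
  shows "norm (pre_extend B u) \<le> K * pre_norm u"
proof -
  have sum: "norm (pre_extend B (pre_sum xs)) \<le> K * pre_cost xs" for xs
  proof (induction xs)
    case (Cons x xs)
    obtain a b where x: "x = (a, b)" by fastforce
    have "norm (pre_extend B (pre_sum (x # xs))) \<le> norm (B a b) + norm (pre_extend B (pre_sum xs))"
      by (simp add: x pre_extend_add norm_triangle_ineq)
    also have "\<dots> \<le> norm a * norm b * K + K * pre_cost xs"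
      by (intro add_mono K Cons)
    finally show ?case by (simp add: x algebra_simps)
  qed simp
  show ?thesis
  proof (rule field_le_epsilon)
    fix e :: real assume e: "0 < e"
    then have "0 < e / (K + 1)" using K(1) by simp
    then obtain xs where xs: "tensor_null (u - pre_sum xs)" "pre_cost xs < pre_norm u + e / (K + 1)"
      using pre_norm_approx by metis
    have "pre_extend B u = pre_extend B (pre_sum xs)"
      using pre_extend_null[OF B xs(1)] by (simp add: pre_extend_diff)
    then have "norm (pre_extend B u) \<le> K * pre_cost xs" using sum by simp
    also have "\<dots> \<le> K * (pre_norm u + e / (K + 1))"
      using xs(2) K(1) by (intro mult_left_mono) auto
    also have "\<dots> = K * pre_norm u + e * (K / (K + 1))" by (simp add: algebra_simps)
    also have "\<dots> \<le> K * pre_norm u + e * 1"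
      using e K(1) by (intro add_left_mono mult_left_mono) auto
    finally show "norm (pre_extend B u) \<le> K * pre_norm u + e" by simp
  qed
qed

lemma tensor_lift_ex1:
  fixes B :: "'a::complex_normed_vector \<Rightarrow> 'b::complex_normed_vector \<Rightarrow> 'c::{complex_normed_vector, banach}"
  assumes B: "bounded_cbilinear B"
  shows "\<exists>!T. bounded_clinear T \<and> (\<forall>a b. T (a \<otimes>\<^sub>\<pi> b) = B a b)"
proof (rule ex_ex1I)
  have "bounded_bilinear B" using B by (simp add: bounded_cbilinear_def)
  then obtain K where K: "0 \<le> K" "\<And>a b. norm (B a b) \<le> norm a * norm b * K"
    using bounded_bilinear.nonneg_bounded by metis
  note bound = pre_extend_bound[OF B K]
  define T where "T x = lim (\<lambda>n. pre_extend B (rep_ptensor x n))" for x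
  have conv: "convergent (\<lambda>n. pre_extend B (X n))" if X: "pre_Cauchy X" for X
  proof -
    have "Cauchy (\<lambda>n. pre_extend B (X n))"
      unfolding Cauchy_iff
    proof (intro allI impI)
      fix e :: real assume "0 < e"
      then have "0 < e / (K + 1)" using K(1) by simp
      with X obtain N where N: "\<forall>m\<ge>N. \<forall>n\<ge>N. pre_norm (X m - X n) < e / (K + 1)"
        unfolding pre_Cauchy_def by meson
      have "norm (pre_extend B (X m) - pre_extend B (X n)) < e" if "m \<ge> N" "n \<ge> N" for m n
      proof -
        have "norm (pre_extend B (X m) - pre_extend B (X n)) \<le> K * pre_norm (X m - X n)"
          using bound[of "X m - X n"] by (simp add: pre_extend_diff)
        also have "\<dots> \<le> (K + 1) * pre_norm (X m - X n)" by (intro mult_right_mono) auto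
        also have "\<dots> < e" using N that K(1) by (simp add: less_divide_eq mult.commute)
        finally show ?thesis .
      qed
      then show "\<exists>N. \<forall>m\<ge>N. \<forall>n\<ge>N. norm (pre_extend B (X m) - pre_extend B (X n)) < e" by blast
    qed
    then show ?thesis by (simp add: Cauchy_convergent_iff)
  qed
  have lim: "(\<lambda>n. pre_extend B (X n)) \<longlonglongrightarrow> T (abs_ptensor X)" if X: "pre_Cauchy X" for X
  proof -
    let ?R = "rep_ptensor (abs_ptensor X)"
    have "pre_rel ?R X"
      using X by (intro rep_abs_rsp_left[OF Quotient3_ptensor]) (simp add: pre_rel_refl_iff)
    then have R: "pre_Cauchy ?R" "(\<lambda>n. pre_norm (?R n - X n)) \<longlonglongrightarrow> 0" by (auto simp: pre_rel_def)
    have "(\<lambda>n. K * pre_norm (?R n - X n)) \<longlonglongrightarrow> 0"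
      using tendsto_mult_right_zero[OF R(2)] .
    then have d: "(\<lambda>n. pre_extend B (?R n) - pre_extend B (X n)) \<longlonglongrightarrow> 0"
      by (rule Lim_null_comparison[rotated]) (simp add: bound flip: pre_extend_diff)
    have "(\<lambda>n. pre_extend B (?R n)) \<longlonglongrightarrow> T (abs_ptensor X)"
      using conv[OF R(1)] by (simp add: T_def convergent_LIMSEQ_iff)
    from tendsto_diff[OF this d] show ?thesis by simp
  qed
  have sc: "T (c *\<^sub>C x) = c *\<^sub>C T x" for c x
  proof -
    obtain X where X: "pre_Cauchy X" "x = abs_ptensor X" by (rule ptensor_cases)
    have "(\<lambda>n. c *\<^sub>C pre_extend B (X n)) \<longlonglongrightarrow> c *\<^sub>C T x"
      unfolding X(2) by (rule bounded_linear.tendsto[OF bounded_linear_scaleC lim[OF X(1)]])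
    moreover have "(\<lambda>n. c *\<^sub>C pre_extend B (X n)) \<longlonglongrightarrow> T (c *\<^sub>C x)"
      using lim[OF pre_Cauchy_scale[OF X(1), of c]]
      by (simp add: X(2) scaleC_ptensor_abs[OF X(1)] pre_extend_scale)
    ultimately show ?thesis by (metis LIMSEQ_unique)
  qed
  have add: "T (x + y) = T x + T y" for x y
  proof -
    obtain X where X: "pre_Cauchy X" "x = abs_ptensor X" by (rule ptensor_cases)
    obtain Y where Y: "pre_Cauchy Y" "y = abs_ptensor Y" by (rule ptensor_cases)
    have "(\<lambda>n. pre_extend B (X n) + pre_extend B (Y n)) \<longlonglongrightarrow> T x + T y"
      unfolding X(2) Y(2) by (intro tendsto_add lim X Y)
    moreover have "(\<lambda>n. pre_extend B (X n) + pre_extend B (Y n)) \<longlonglongrightarrow> T (x + y)"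
      using lim[OF pre_Cauchy_add[OF X(1) Y(1)]]
      by (simp add: X(2) Y(2) plus_ptensor_abs[OF X(1) Y(1)] pre_extend_add)
    ultimately show ?thesis by (metis LIMSEQ_unique)
  qed
  have bd: "norm (T x) \<le> norm x * K" for x
  proof -
    obtain X where X: "pre_Cauchy X" "x = abs_ptensor X" by (rule ptensor_cases)
    have l: "(\<lambda>n. norm (pre_extend B (X n))) \<longlonglongrightarrow> norm (T x)"
      unfolding X(2) by (intro tendsto_norm lim X)
    have r: "(\<lambda>n. K * pre_norm (X n)) \<longlonglongrightarrow> K * norm x"
      unfolding X(2) by (intro tendsto_mult_left norm_ptensor_lim X)
    have "norm (T x) \<le> K * norm x"
      by (rule LIMSEQ_le[OF l r]) (use bound in blast)
    then show ?thesis by (simp add: mult.commute)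
  qed
  have "bounded_linear T"
    by (rule bounded_linear_intro[OF add _ bd]) (simp add: sc flip: scaleC_of_real)
  then have "bounded_clinear T" by (simp add: bounded_clinear_def sc)
  moreover have "T (a \<otimes>\<^sub>\<pi> b) = B a b" for a b
    using lim[OF pre_Cauchy_const[of "pre_elem a b"]]
    by (simp add: LIMSEQ_const_iff tensor_def pre_embed_def)
  ultimately show "\<exists>T. bounded_clinear T \<and> (\<forall>a b. T (a \<otimes>\<^sub>\<pi> b) = B a b)" by blast
next
  fix S T :: "('a, 'b) ptensor \<Rightarrow> 'c"
  assume S: "bounded_clinear S \<and> (\<forall>a b. S (a \<otimes>\<^sub>\<pi> b) = B a b)"
    and T: "bounded_clinear T \<and> (\<forall>a b. T (a \<otimes>\<^sub>\<pi> b) = B a b)"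
  have diff: "c *\<^sub>C y - c *\<^sub>C z = c *\<^sub>C (y - z)" for c and y z :: 'c
    using scaleC_add_right[of c "y - z" z] by simp
  have "bounded_clinear (\<lambda>x. S x - T x)"
    using S T by (simp add: bounded_clinear_def bounded_linear_sub diff)
  then have "S x - T x = 0" for x
    by (rule clinear_eq_0_on_tensors) (simp add: S T)
  then show "S = T" by (simp add: fun_eq_iff)
qed

definition tensor_lift :: "('a::complex_normed_vector \<Rightarrow> 'b::complex_normed_vector \<Rightarrow>
    'c::{complex_normed_vector, banach}) \<Rightarrow> ('a, 'b) ptensor \<Rightarrow> 'c" where
  "tensor_lift B = (THE T. bounded_clinear T \<and> (\<forall>a b. T (a \<otimes>\<^sub>\<pi> b) = B a b))"

lemma tensor_lift:
  assumes "bounded_cbilinear B"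
  shows bounded_clinear_tensor_lift: "bounded_clinear (tensor_lift B)"
    and tensor_lift_tensor: "tensor_lift B (a \<otimes>\<^sub>\<pi> b) = B a b"
  using theI'[OF tensor_lift_ex1[OF assms]] unfolding tensor_lift_def by blast+

definition tensor_lact :: "'a::complex_banach_algebra \<Rightarrow> ('a, 'a) ptensor \<Rightarrow> ('a, 'a) ptensor" where
  "tensor_lact a = tensor_lift (\<lambda>b c. (a * b) \<otimes>\<^sub>\<pi> c)"

definition tensor_ract :: "'a::complex_banach_algebra \<Rightarrow> ('a, 'a) ptensor \<Rightarrow> ('a, 'a) ptensor" where
  "tensor_ract a = tensor_lift (\<lambda>b c. b \<otimes>\<^sub>\<pi> (c * a))"

definition tensor_mult :: "('a, 'a) ptensor \<Rightarrow> 'a::complex_banach_algebra" where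
  "tensor_mult = tensor_lift (*)"

lemma bounded_cbilinear_mult: "bounded_cbilinear ((*) :: 'a \<Rightarrow> 'a \<Rightarrow> 'a::complex_banach_algebra)"
  by (simp add: bounded_cbilinear_def bounded_bilinear_mult mult_scaleC_left mult_scaleC_right)

lemma bounded_cbilinear_lact: "bounded_cbilinear (\<lambda>b (c::'a). (a * b) \<otimes>\<^sub>\<pi> c)"
  for a :: "'a::complex_banach_algebra"
proof -
  have "bounded_bilinear (\<lambda>b (c::'a). (a * b) \<otimes>\<^sub>\<pi> c)"
    using bounded_cbilinear_tensor[where 'a='a and 'b='a]
    by (intro bounded_bilinear.comp[OF _ bounded_linear_mult_right bounded_linear_ident])
       (simp add: bounded_cbilinear_def)
  then show ?thesis
    by (simp add: bounded_cbilinear_def mult_scaleC_right tensor_scaleC_left tensor_scaleC_right)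
qed

lemma bounded_cbilinear_ract: "bounded_cbilinear (\<lambda>(b::'a) c. b \<otimes>\<^sub>\<pi> (c * a))"
  for a :: "'a::complex_banach_algebra"
proof -
  have "bounded_bilinear (\<lambda>(b::'a) c. b \<otimes>\<^sub>\<pi> (c * a))"
    using bounded_cbilinear_tensor[where 'a='a and 'b='a]
    by (intro bounded_bilinear.comp[OF _ bounded_linear_ident bounded_linear_mult_left])
       (simp add: bounded_cbilinear_def)
  then show ?thesis
    by (simp add: bounded_cbilinear_def mult_scaleC_left tensor_scaleC_left tensor_scaleC_right)
qed

lemma tensor_lact: "bounded_clinear (tensor_lact a)" "tensor_lact a (b \<otimes>\<^sub>\<pi> c) = (a * b) \<otimes>\<^sub>\<pi> c"
  unfolding tensor_lact_def by (simp_all add: tensor_lift bounded_cbilinear_lact)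

lemma tensor_ract: "bounded_clinear (tensor_ract a)" "tensor_ract a (b \<otimes>\<^sub>\<pi> c) = b \<otimes>\<^sub>\<pi> (c * a)"
  unfolding tensor_ract_def by (simp_all add: tensor_lift bounded_cbilinear_ract)

lemma tensor_mult: "bounded_clinear tensor_mult" "tensor_mult (a \<otimes>\<^sub>\<pi> b) = a * b"
  unfolding tensor_mult_def by (simp_all add: tensor_lift bounded_cbilinear_mult)

section \<open>Duals, weak topologies and nets\<close>

text \<open>
  The dual of a complex normed space is the set \<open>cdual\<close> of complex-linear elements of the
  library's space of bounded real-linear functionals, with the operator norm; the norms agree.
\<close>

definition cdual :: "('v::complex_normed_vector \<Rightarrow>\<^sub>L complex) set" where
  "cdual = {f. bounded_clinear (blinfun_apply f)}"

definition csubspace :: "'v::complex_normed_vector set \<Rightarrow> bool" where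
  "csubspace S \<longleftrightarrow> 0 \<in> S \<and> (\<forall>x\<in>S. \<forall>y\<in>S. x + y \<in> S) \<and> (\<forall>c. \<forall>x\<in>S. c *\<^sub>C x \<in> S)"

text \<open>
  The dual of a subspace \<open>S\<close> of a normed space; functionals on \<open>S\<close> are represented by
  functions vanishing off \<open>S\<close>.
\<close>

definition dual_on :: "'v::complex_normed_vector set \<Rightarrow> ('v \<Rightarrow> complex) set" where
  "dual_on S = {\<phi>.
     (\<forall>x\<in>S. \<forall>y\<in>S. \<phi> (x + y) = \<phi> x + \<phi> y) \<and>
     (\<forall>c. \<forall>x\<in>S. \<phi> (c *\<^sub>C x) = c * \<phi> x) \<and>
     (\<exists>K. \<forall>x\<in>S. cmod (\<phi> x) \<le> K * norm x) \<and>
     (\<forall>x. x \<notin> S \<longrightarrow> \<phi> x = 0)}"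

definition eval_on :: "('v::real_normed_vector \<Rightarrow>\<^sub>L complex) set \<Rightarrow> 'v \<Rightarrow> ('v \<Rightarrow>\<^sub>L complex) \<Rightarrow> complex" where
  "eval_on S x = (\<lambda>f. if f \<in> S then blinfun_apply f x else 0)"

definition adjoint_op ::
    "('v::real_normed_vector \<Rightarrow> 'w::real_normed_vector) \<Rightarrow> ('w \<Rightarrow>\<^sub>L complex) \<Rightarrow> ('v \<Rightarrow>\<^sub>L complex)" where
  "adjoint_op T f = Blinfun (\<lambda>x. blinfun_apply f (T x))"

definition adjoint_on :: "'v set \<Rightarrow> ('v \<Rightarrow> 'w) \<Rightarrow> ('w \<Rightarrow> complex) \<Rightarrow> ('v \<Rightarrow> complex)" where
  "adjoint_on S T \<phi> = (\<lambda>x. if x \<in> S then \<phi> (T x) else 0)"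

lemma blinfun_apply_adjoint_op:
  "bounded_linear T \<Longrightarrow> blinfun_apply (adjoint_op T f) x = blinfun_apply f (T x)"
  unfolding adjoint_op_def
  by (subst bounded_linear_Blinfun_apply) (auto intro: bounded_linear_compose[OF blinfun.bounded_linear_right])

text \<open>\<open>sigma_topology X Y b\<close> is the topology \<open>\<sigma>(X, Y)\<close> for the pairing \<open>b\<close>.\<close>

definition sigma_topology :: "'x set \<Rightarrow> 'y set \<Rightarrow> ('x \<Rightarrow> 'y \<Rightarrow> complex) \<Rightarrow> 'x topology" where
  "sigma_topology X Y b =
     pullback_topology X (\<lambda>x. \<lambda>y\<in>Y. b x y) (product_topology (\<lambda>_. euclidean) Y)"

definition weak_topology :: "'v::complex_normed_vector set \<Rightarrow> 'v topology" where
  "weak_topology E = sigma_topology E (dual_on E) (\<lambda>x \<phi>. \<phi> x)"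

definition weak_star_topology :: "'v::complex_normed_vector set \<Rightarrow> ('v \<Rightarrow> complex) topology" where
  "weak_star_topology S = sigma_topology (dual_on S) S (\<lambda>\<phi> x. \<phi> x)"

definition directed :: "'i set \<Rightarrow> ('i \<Rightarrow> 'i \<Rightarrow> bool) \<Rightarrow> bool" where
  "directed I le \<longleftrightarrow> I \<noteq> {} \<and> (\<forall>i\<in>I. le i i) \<and>
     (\<forall>i\<in>I. \<forall>j\<in>I. \<forall>k\<in>I. le i j \<longrightarrow> le j k \<longrightarrow> le i k) \<and>
     (\<forall>i\<in>I. \<forall>j\<in>I. \<exists>k\<in>I. le i k \<and> le j k)"

definition net_filter :: "'i set \<Rightarrow> ('i \<Rightarrow> 'i \<Rightarrow> bool) \<Rightarrow> 'i filter" where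
  "net_filter I le = (INF i\<in>I. principal {j\<in>I. le i j})"

lemma eventually_net_filter:
  assumes "directed I le"
  shows "eventually Q (net_filter I le) \<longleftrightarrow> (\<exists>i\<in>I. \<forall>j\<in>I. le i j \<longrightarrow> Q j)"
proof -
  have "eventually Q (net_filter I le) \<longleftrightarrow> (\<exists>i\<in>I. eventually Q (principal {j\<in>I. le i j}))"
    unfolding net_filter_def
  proof (rule eventually_INF_base)
    show "I \<noteq> {}" using assms by (simp add: directed_def)
    fix i j assume ij: "i \<in> I" "j \<in> I"
    with assms obtain k where k: "k \<in> I" "le i k" "le j k" unfolding directed_def by blast
    with assms ij have "{l\<in>I. le k l} \<subseteq> {l\<in>I. le i l} \<inter> {l\<in>I. le j l}"
      unfolding directed_def by blast
    with k(1) show "\<exists>x\<in>I. principal {l\<in>I. le x l} \<le>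
        inf (principal {l\<in>I. le i l}) (principal {l\<in>I. le j l})"
      by (intro bexI[of _ k]) auto
  qed
  then show ?thesis by (auto simp: eventually_principal)
qed

section \<open>Dual Banach algebras and pseudo-Connes amenability\<close>

text \<open>
  \<open>P\<close> is the predual. The identification of the algebra with \<open>P\<^sup>*\<close> is by evaluation; it is
  bounded, so bijectivity makes it an isomorphism of Banach spaces. It is not required to be
  isometric.
\<close>

definition dual_banach_algebra :: "('a::complex_banach_algebra \<Rightarrow>\<^sub>L complex) set \<Rightarrow> bool" where
  "dual_banach_algebra P \<longleftrightarrow>
     P \<subseteq> cdual \<and> csubspace P \<and> closed P \<and>
     (\<forall>a. \<forall>f\<in>P. adjoint_op (\<lambda>x. x * a) f \<in> P \<and> adjoint_op (\<lambda>x. a * x) f \<in> P) \<and>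
     bij_betw (eval_on P) UNIV (dual_on P)"

definition wk_star :: "('a::complex_banach_algebra \<Rightarrow>\<^sub>L complex) set \<Rightarrow> 'a topology" where
  "wk_star P = sigma_topology UNIV P (\<lambda>a f. blinfun_apply f a)"

text \<open>
  Left and right actions of \<open>a\<close> on a bimodule with carrier \<open>E\<close> are given as
  \<open>l a x = a \<cdot> x\<close> and \<open>r a x = x \<cdot> a\<close>.
\<close>

definition sigma_wc :: "('a::complex_banach_algebra \<Rightarrow>\<^sub>L complex) set \<Rightarrow> 'e::complex_normed_vector set \<Rightarrow>
    ('a \<Rightarrow> 'e \<Rightarrow> 'e) \<Rightarrow> ('a \<Rightarrow> 'e \<Rightarrow> 'e) \<Rightarrow> 'e set" where
  "sigma_wc P E l r = {x\<in>E.
     continuous_map (wk_star P) (weak_topology E) (\<lambda>a. l a x) \<and>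
     continuous_map (wk_star P) (weak_topology E) (\<lambda>a. r a x)}"

text \<open>
  On a dual module \<open>a \<cdot> \<phi>\<close> is \<open>\<phi>\<close> composed with the right action of \<open>a\<close>, and
  \<open>\<phi> \<cdot> a\<close> is \<open>\<phi>\<close> composed with the left action.
\<close>

definition form_lact :: "'a::complex_banach_algebra \<Rightarrow> (('a, 'a) ptensor \<Rightarrow>\<^sub>L complex) \<Rightarrow> (('a, 'a) ptensor \<Rightarrow>\<^sub>L complex)" where
  "form_lact a = adjoint_op (tensor_ract a)"

definition form_ract :: "'a::complex_banach_algebra \<Rightarrow> (('a, 'a) ptensor \<Rightarrow>\<^sub>L complex) \<Rightarrow> (('a, 'a) ptensor \<Rightarrow>\<^sub>L complex)" where
  "form_ract a = adjoint_op (tensor_lact a)"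

definition swc :: "('a::complex_banach_algebra \<Rightarrow>\<^sub>L complex) set \<Rightarrow> (('a, 'a) ptensor \<Rightarrow>\<^sub>L complex) set" where
  "swc P = sigma_wc P cdual form_lact form_ract"

definition swc_dual_lact :: "('a::complex_banach_algebra \<Rightarrow>\<^sub>L complex) set \<Rightarrow> 'a \<Rightarrow>
    ((('a, 'a) ptensor \<Rightarrow>\<^sub>L complex) \<Rightarrow> complex) \<Rightarrow> (('a, 'a) ptensor \<Rightarrow>\<^sub>L complex) \<Rightarrow> complex" where
  "swc_dual_lact P a = adjoint_on (swc P) (form_ract a)"

definition swc_dual_ract :: "('a::complex_banach_algebra \<Rightarrow>\<^sub>L complex) set \<Rightarrow> 'a \<Rightarrow>
    ((('a, 'a) ptensor \<Rightarrow>\<^sub>L complex) \<Rightarrow> complex) \<Rightarrow> (('a, 'a) ptensor \<Rightarrow>\<^sub>L complex) \<Rightarrow> complex" where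
  "swc_dual_ract P a = adjoint_on (swc P) (form_lact a)"

text \<open>
  The adjoint of \<open>\<pi>\<^sup>*\<close> restricted to \<open>P\<close>, with values in \<open>P\<^sup>*\<close> read back in the algebra.
\<close>

definition pi_swc :: "('a::complex_banach_algebra \<Rightarrow>\<^sub>L complex) set \<Rightarrow>
    ((('a, 'a) ptensor \<Rightarrow>\<^sub>L complex) \<Rightarrow> complex) \<Rightarrow> 'a" where
  "pi_swc P m = the_inv_into UNIV (eval_on P) (adjoint_on P (adjoint_op tensor_mult) m)"

text \<open>
  HOL cannot quantify over the type of net indices inside a formula, so both properties carry
  it as a parameter. For pseudo-Connes amenability the lemma \<open>pseudo_Connes_amenable_reindex\<close>
  shows that one fixed index type suffices for all nets.
\<close>

definition strong_pseudo_Connes_amenable ::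
    "'i itself \<Rightarrow> ('a::complex_banach_algebra \<Rightarrow>\<^sub>L complex) set \<Rightarrow> bool" where
  "strong_pseudo_Connes_amenable _ P \<longleftrightarrow>
     (\<exists>(I :: 'i set) le m. directed I le \<and> (\<forall>i\<in>I. m i \<in> dual_on (swc P)) \<and>
        (\<forall>a.
           limitin (weak_star_topology (swc P))
             (\<lambda>i \<phi>. swc_dual_lact P a (m i) \<phi> - swc_dual_ract P a (m i) \<phi>) (\<lambda>\<phi>. 0) (net_filter I le) \<and>
           (\<forall>i\<in>I. a * pi_swc P (m i) = pi_swc P (m i) * a) \<and>
           limitin (wk_star P) (\<lambda>i. a * pi_swc P (m i)) a (net_filter I le)))"

definition pseudo_Connes_amenable ::
    "'i itself \<Rightarrow> ('a::complex_banach_algebra \<Rightarrow>\<^sub>L complex) set \<Rightarrow> bool" where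
  "pseudo_Connes_amenable _ P \<longleftrightarrow>
     (\<exists>(I :: 'i set) le (u :: 'i \<Rightarrow> ('a, 'a) ptensor). directed I le \<and>
        (\<forall>a.
           limitin (weak_star_topology (swc P))
             (\<lambda>i \<phi>. swc_dual_lact P a (eval_on (swc P) (u i)) \<phi> - swc_dual_ract P a (eval_on (swc P) (u i)) \<phi>)
             (\<lambda>\<phi>. 0) (net_filter I le) \<and>
           limitin (wk_star P) (\<lambda>i. a * pi_swc P (eval_on (swc P) (u i))) a (net_filter I le)))"

lemma pseudo_Connes_amenable_reindex:
  fixes P :: "('a::complex_banach_algebra \<Rightarrow>\<^sub>L complex) set"
  assumes "pseudo_Connes_amenable TYPE('i) P"
  shows "pseudo_Connes_amenable TYPE(('a, 'a) ptensor set \<times> ('a, 'a) ptensor) P"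
proof -
  define L where "L a v = (\<lambda>\<phi>. swc_dual_lact P a (eval_on (swc P) v) \<phi> -
    swc_dual_ract P a (eval_on (swc P) v) \<phi>)" for a v
  define R where "R a v = a * pi_swc P (eval_on (swc P) v)" for a v
  obtain I :: "'i set" and le and u :: "'i \<Rightarrow> ('a, 'a) ptensor" where dir: "directed I le"
    and lim1: "\<And>a. limitin (weak_star_topology (swc P)) (\<lambda>i. L a (u i)) (\<lambda>\<phi>. 0) (net_filter I le)"
    and lim2: "\<And>a. limitin (wk_star P) (\<lambda>i. R a (u i)) a (net_filter I le)"
    using assms unfolding pseudo_Connes_amenable_def L_def R_def by blast
  define F where "F = filtermap u (net_filter I le)"
  define J where "J = {(S, x). eventually (\<lambda>y. y \<in> S) F \<and> x \<in> S}"
  define leJ :: "(('a, 'a) ptensor set \<times> ('a, 'a) ptensor) \<Rightarrow> (('a, 'a) ptensor set \<times> ('a, 'a) ptensor) \<Rightarrow> bool"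
    where "leJ p q \<longleftrightarrow> fst q \<subseteq> fst p" for p q
  have "\<not> eventually (\<lambda>_. False) (net_filter I le)"
    unfolding eventually_net_filter[OF dir] using dir unfolding directed_def by blast
  then have nb: "\<exists>x. x \<in> S" if "eventually (\<lambda>y. y \<in> S) F" for S
    using that unfolding F_def eventually_filtermap by (metis (mono_tags, lifting) eventually_mono)
  have dirJ: "directed J leJ"
    unfolding directed_def
  proof (intro conjI ballI impI)
    have "(UNIV, 0) \<in> J" by (simp add: J_def)
    then show "J \<noteq> {}" by blast
    fix p q assume "p \<in> J" "q \<in> J"
    then have ev: "eventually (\<lambda>y. y \<in> fst p \<inter> fst q) F"
      by (auto simp: J_def eventually_conj)
    from nb[OF this] obtain x where "x \<in> fst p \<inter> fst q" by blast
    with ev have "(fst p \<inter> fst q, x) \<in> J" by (simp add: J_def)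
    then show "\<exists>k\<in>J. leJ p k \<and> leJ q k" by (rule bexI[rotated]) (auto simp: leJ_def)
  qed (auto simp: leJ_def)
  have tail: "eventually (\<lambda>j. Q (snd j)) (net_filter J leJ)"
    if "eventually (\<lambda>i. Q (u i)) (net_filter I le)" for Q
  proof -
    have ev: "eventually (\<lambda>y. y \<in> Collect Q) F" using that by (simp add: F_def eventually_filtermap)
    from nb[OF this] obtain x where "x \<in> Collect Q" by blast
    with ev have "(Collect Q, x) \<in> J" by (simp add: J_def)
    then show ?thesis
      unfolding eventually_net_filter[OF dirJ]
      by (rule bexI[rotated]) (auto simp: J_def leJ_def)
  qed
  have tr1: "limitin (weak_star_topology (swc P)) (\<lambda>j. L a (snd j)) (\<lambda>\<phi>. 0) (net_filter J leJ)" for a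
    using lim1[of a] tail[of "\<lambda>v. L a v \<in> _"] unfolding limitin_def by blast
  have tr2: "limitin (wk_star P) (\<lambda>j. R a (snd j)) a (net_filter J leJ)" for a
    using lim2[of a] tail[of "\<lambda>v. R a v \<in> _"] unfolding limitin_def by blast
  show ?thesis
    unfolding pseudo_Connes_amenable_def
    by (rule exI[of _ J], rule exI[of _ leJ], rule exI[of _ snd])
       (use dirJ tr1 tr2 in \<open>auto simp: L_def R_def\<close>)
qed

end

theory Submission
  imports Defs
begin

text \<open>
  Write \<open>S\<close> for \<open>swc P\<close>, a space of functionals on the projective tensor product \<open>V\<close>.
  The idea is that \<open>V\<close> is weak-star dense in the dual of \<open>S\<close>, so a net \<open>m\<close> in that dual can be
  replaced by a net in \<open>V\<close>. As nets may be unbounded, the approximation is pure linear algebra: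
  on any prescribed finite subset of \<open>S\<close>, a linear functional on \<open>S\<close> agrees with evaluation at
  some \<open>u\<close> of \<open>V\<close> (\<open>finite_interpolation\<close>). The new net is indexed by pairs \<open>(i, F)\<close> with \<open>F\<close> a finite subset
  of \<open>S\<close>, and \<open>u (i, F)\<close> agrees with \<open>m i\<close> on \<open>F\<close>; so for each single \<open>\<phi>\<close> in \<open>S\<close> the value
  \<open>\<phi> (u (i, F))\<close> eventually equals \<open>m i \<phi>\<close>.

  Both convergence conditions are families of scalar limits, each of which involves the net only
  through its values at one or two functionals in \<open>S\<close>.
  For \<open>\<phi>\<close> in \<open>S\<close>, the number \<open>(a \<cdot> u - u \<cdot> a) \<phi>\<close> is the difference of the values at \<open>u\<close> of
  \<open>\<phi> \<cdot> a\<close> and \<open>a \<cdot> \<phi>\<close>, which lie in \<open>S\<close> since \<open>S\<close> is a sub-bimodule (\<open>form_lact_swc\<close>,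
  \<open>form_ract_swc\<close>). For \<open>f\<close> in the predual \<open>P\<close>, the number \<open>f (a * \<pi> u)\<close> is the value at \<open>u\<close> of
  \<open>\<pi>\<^sup>* (f \<cdot> a)\<close>, which lies in \<open>S\<close> because \<open>\<pi>\<^sup>*\<close> maps \<open>P\<close> into \<open>S\<close> (\<open>adjoint_mult_swc\<close>).
  Thus each limit along the old net carries over to the new one, and
  \<open>pseudo_Connes_amenable_reindex\<close> changes the index type.
\<close>

section \<open>Weak topologies\<close>

lemma topspace_sigma_topology [simp]: "topspace (sigma_topology X Y b) = X"
  by (auto simp: sigma_topology_def topspace_pullback_topology PiE_def extensional_def)

lemma continuous_map_sigma_topology_iff:
  fixes b :: "'x \<Rightarrow> 'y \<Rightarrow> complex"
  shows "continuous_map T (sigma_topology X Y b) g \<longleftrightarrow>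
     g \<in> topspace T \<rightarrow> X \<and> (\<forall>y\<in>Y. continuous_map T euclidean (\<lambda>t. b (g t) y))"
    (is "?L \<longleftrightarrow> ?R")
proof
  let ?e = "\<lambda>x. \<lambda>y\<in>Y. b x y" and ?\<Pi> = "product_topology (\<lambda>_. euclidean) Y :: ('y \<Rightarrow> complex) topology"
  have eval: "continuous_map (sigma_topology X Y b) ?\<Pi> ?e"
    unfolding sigma_topology_def
    using continuous_map_pullback[of ?\<Pi> ?\<Pi> id X ?e] by (simp add: o_def)
  assume L: ?L
  have "continuous_map T ?\<Pi> (?e \<circ> g)" by (rule continuous_map_compose[OF L eval])
  then have "continuous_map T euclidean (\<lambda>t. b (g t) y)" if "y \<in> Y" for y
    using that by (simp add: continuous_map_componentwise)
  moreover have "g \<in> topspace T \<rightarrow> X" using L by (simp add: continuous_map_def)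
  ultimately show ?R by blast
next
  assume R: ?R
  show ?L
    unfolding sigma_topology_def
  proof (rule continuous_map_pullback')
    show "continuous_map T (product_topology (\<lambda>_. euclidean) Y) ((\<lambda>x. \<lambda>y\<in>Y. b x y) \<circ> g)"
      using R by (auto simp: continuous_map_componentwise)
    show "topspace T \<subseteq> g -` X" using R by auto
  qed
qed

lemma limitin_sigma_topology_iff:
  fixes b :: "'x \<Rightarrow> 'y \<Rightarrow> complex"
  shows "limitin (sigma_topology X Y b) g l F \<longleftrightarrow>
     l \<in> X \<and> eventually (\<lambda>i. g i \<in> X) F \<and> (\<forall>y\<in>Y. ((\<lambda>i. b (g i) y) \<longlongrightarrow> b l y) F)"
    (is "?L \<longleftrightarrow> ?R")
proof
  assume L: ?L
  have X: "l \<in> X" using L by (simp add: limitin_def)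
  have "eventually (\<lambda>i. g i \<in> X) F"
    using L openin_topspace[of "sigma_topology X Y b"] by (auto simp: limitin_def)
  moreover have "((\<lambda>i. b (g i) y) \<longlongrightarrow> b l y) F" if "y \<in> Y" for y
  proof -
    have "continuous_map (sigma_topology X Y b) euclidean (\<lambda>x. b x y)"
      using that continuous_map_id[of "sigma_topology X Y b"]
      unfolding continuous_map_sigma_topology_iff by simp
    from continuous_map_limit[OF this L] show ?thesis by (simp add: o_def)
  qed
  ultimately show ?R using X by blast
next
  assume R: ?R
  let ?e = "\<lambda>x. \<lambda>y\<in>Y. b x y" and ?\<Pi> = "product_topology (\<lambda>_. euclidean) Y :: ('y \<Rightarrow> complex) topology"
  have lim: "limitin ?\<Pi> (\<lambda>i. ?e (g i)) (?e l) F"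
    using R by (simp add: limitin_componentwise)
  show ?L
    unfolding limitin_def
  proof (intro conjI allI impI)
    fix W assume "openin (sigma_topology X Y b) W \<and> l \<in> W"
    then obtain U where U: "openin ?\<Pi> U" "W = ?e -` U \<inter> X" "?e l \<in> U"
      by (auto simp: sigma_topology_def openin_pullback_topology)
    then have "eventually (\<lambda>i. ?e (g i) \<in> U) F" using lim by (simp add: limitin_def)
    moreover have "eventually (\<lambda>i. g i \<in> X) F" using R by blast
    ultimately show "eventually (\<lambda>i. g i \<in> W) F" by eventually_elim (simp add: U(2))
  qed (use R in simp)
qed

lemma continuous_map_wk_star_apply:
  "f \<in> P \<Longrightarrow> continuous_map (wk_star P) euclidean (blinfun_apply f)"
  using continuous_map_id[of "wk_star P"]
  unfolding wk_star_def continuous_map_sigma_topology_iff by simp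

section \<open>Adjoints and duals of subspaces\<close>

lemma cdual_apply:
  assumes "f \<in> cdual"
  shows "blinfun_apply f (x + y) = blinfun_apply f x + blinfun_apply f y"
    and "blinfun_apply f (x - y) = blinfun_apply f x - blinfun_apply f y"
    and "blinfun_apply f (c *\<^sub>C x) = c * blinfun_apply f x"
  using assms by (simp_all add: cdual_def bounded_clinear_def blinfun.bilinear_simps scaleC_complex_def)

lemma bounded_clinear_mult_left: "bounded_clinear (\<lambda>x. x * (a::'a::complex_banach_algebra))"
  by (simp add: bounded_clinear_def bounded_linear_mult_left mult_scaleC_left)

lemma bounded_clinear_mult_right: "bounded_clinear (\<lambda>x. (a::'a::complex_banach_algebra) * x)"
  by (simp add: bounded_clinear_def bounded_linear_mult_right mult_scaleC_right)

lemma bounded_clinear_compose: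
  "bounded_clinear S \<Longrightarrow> bounded_clinear T \<Longrightarrow> bounded_clinear (\<lambda>x. S (T x))"
  by (auto simp: bounded_clinear_def intro: bounded_linear_compose)

lemma adjoint_op_apply:
  "bounded_clinear T \<Longrightarrow> blinfun_apply (adjoint_op T f) = (\<lambda>x. blinfun_apply f (T x))"
  by (simp add: bounded_clinear_def blinfun_apply_adjoint_op fun_eq_iff)

lemma adjoint_op_cdual: "bounded_clinear T \<Longrightarrow> f \<in> cdual \<Longrightarrow> adjoint_op T f \<in> cdual"
  using bounded_clinear_compose[of "blinfun_apply f" T] by (simp add: cdual_def adjoint_op_apply)

lemma adjoint_op_add:
  "bounded_clinear T \<Longrightarrow> adjoint_op T (f + g) = adjoint_op T f + adjoint_op T g"
  by (rule blinfun_eqI) (simp add: adjoint_op_apply blinfun.add_left)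

lemma adjoint_op_scaleC:
  "bounded_clinear T \<Longrightarrow> adjoint_op T (c *\<^sub>C f) = c *\<^sub>C adjoint_op T f"
  by (rule blinfun_eqI) (simp add: adjoint_op_apply scaleC_blinfun.rep_eq)

lemma adjoint_op_bound:
  assumes "bounded_clinear T"
  shows "\<exists>K\<ge>0. \<forall>f. norm (adjoint_op T f) \<le> K * norm f"
proof -
  have "bounded_linear T" using assms by (simp add: bounded_clinear_def)
  then obtain K where K: "0 \<le> K" "\<And>x. norm (T x) \<le> norm x * K"
    using bounded_linear.nonneg_bounded by blast
  have "norm (adjoint_op T f) \<le> K * norm f" for f
  proof (rule norm_blinfun_bound)
    fix x
    have "norm (blinfun_apply f (T x)) \<le> norm f * norm (T x)" by (rule norm_blinfun)
    also have "\<dots> \<le> norm f * (norm x * K)" by (intro mult_left_mono K) simp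
    finally show "norm (blinfun_apply (adjoint_op T f) x) \<le> K * norm f * norm x"
      by (simp add: adjoint_op_apply[OF assms] mult_ac)
  qed (simp add: K)
  with K(1) show ?thesis by blast
qed

lemma csubspace_cdual: "csubspace cdual"
  by (auto simp: csubspace_def cdual_def bounded_clinear_def blinfun.bounded_linear_right
      blinfun.bilinear_simps scaleC_blinfun.rep_eq scaleC_add_right scaleC_scaleC mult.commute)

lemma dual_on_apply:
  assumes "\<phi> \<in> dual_on S"
  shows dual_on_add: "x \<in> S \<Longrightarrow> y \<in> S \<Longrightarrow> \<phi> (x + y) = \<phi> x + \<phi> y"
    and dual_on_scaleC: "x \<in> S \<Longrightarrow> \<phi> (c *\<^sub>C x) = c * \<phi> x"
  using assms by (auto simp: dual_on_def)

lemma dual_on_diff: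
  assumes "\<phi> \<in> dual_on S" "\<psi> \<in> dual_on S"
  shows "(\<lambda>x. \<phi> x - \<psi> x) \<in> dual_on S"
proof -
  obtain K L where K: "\<forall>x\<in>S. cmod (\<phi> x) \<le> K * norm x" and L: "\<forall>x\<in>S. cmod (\<psi> x) \<le> L * norm x"
    using assms unfolding dual_on_def by blast
  have "cmod (\<phi> x - \<psi> x) \<le> (K + L) * norm x" if "x \<in> S" for x
    using norm_triangle_ineq4[of "\<phi> x" "\<psi> x"] K L that by (fastforce simp: distrib_right)
  then have "\<exists>K. \<forall>x\<in>S. cmod (\<phi> x - \<psi> x) \<le> K * norm x" by blast
  then show ?thesis using assms unfolding dual_on_def by (simp add: algebra_simps)
qed

lemma adjoint_on_dual_on:
  assumes T: "bounded_clinear T" and S: "csubspace S" and maps: "\<And>f. f \<in> S \<Longrightarrow> adjoint_op T f \<in> R"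
    and \<phi>: "\<phi> \<in> dual_on R"
  shows "adjoint_on S (adjoint_op T) \<phi> \<in> dual_on S"
proof -
  obtain K where K: "\<forall>g\<in>R. cmod (\<phi> g) \<le> K * norm g" using \<phi> unfolding dual_on_def by blast
  obtain C where C: "0 \<le> C" "\<forall>f. norm (adjoint_op T f) \<le> C * norm f"
    using adjoint_op_bound[OF T] by blast
  have bound: "cmod (\<phi> (adjoint_op T f)) \<le> (\<bar>K\<bar> * C) * norm f" if "f \<in> S" for f
  proof -
    have "cmod (\<phi> (adjoint_op T f)) \<le> K * norm (adjoint_op T f)" using K maps that by blast
    also have "\<dots> \<le> \<bar>K\<bar> * norm (adjoint_op T f)" by (intro mult_right_mono) auto
    also have "\<dots> \<le> \<bar>K\<bar> * (C * norm f)" using C by (intro mult_left_mono) auto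
    finally show ?thesis by (simp add: mult.assoc)
  qed
  have val: "adjoint_on S (adjoint_op T) \<phi> f = \<phi> (adjoint_op T f)" if "f \<in> S" for f
    using that by (simp add: adjoint_on_def)
  show ?thesis
    unfolding dual_on_def[of S]
  proof (intro CollectI conjI ballI allI impI exI[of _ "\<bar>K\<bar> * C"])
    fix f g assume "f \<in> S" "g \<in> S"
    moreover from this have "f + g \<in> S" using S by (simp add: csubspace_def)
    ultimately show "adjoint_on S (adjoint_op T) \<phi> (f + g) =
        adjoint_on S (adjoint_op T) \<phi> f + adjoint_on S (adjoint_op T) \<phi> g"
      using maps by (simp add: val adjoint_op_add[OF T] dual_on_add[OF \<phi>])
  next
    fix c f assume "f \<in> S"
    moreover from this have "c *\<^sub>C f \<in> S" using S by (simp add: csubspace_def)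
    ultimately show "adjoint_on S (adjoint_op T) \<phi> (c *\<^sub>C f) = c * adjoint_on S (adjoint_op T) \<phi> f"
      using maps by (simp add: val adjoint_op_scaleC[OF T] dual_on_scaleC[OF \<phi>])
  next
    show "cmod (adjoint_on S (adjoint_op T) \<phi> f) \<le> \<bar>K\<bar> * C * norm f" if "f \<in> S" for f
      using bound that by (simp add: val)
    show "adjoint_on S (adjoint_op T) \<phi> f = 0" if "f \<notin> S" for f
      using that by (simp add: adjoint_on_def)
  qed
qed

lemma eval_on_dual_on:
  assumes S: "csubspace S"
  shows "eval_on S x \<in> dual_on S"
  unfolding dual_on_def
proof (intro CollectI conjI ballI allI impI exI[of _ "norm x"])
  fix f g assume "f \<in> S" "g \<in> S"
  moreover from this have "f + g \<in> S" using S by (simp add: csubspace_def)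
  ultimately show "eval_on S x (f + g) = eval_on S x f + eval_on S x g"
    by (simp add: eval_on_def blinfun.add_left)
next
  fix c f assume "f \<in> S"
  moreover from this have "c *\<^sub>C f \<in> S" using S by (simp add: csubspace_def)
  ultimately show "eval_on S x (c *\<^sub>C f) = c * eval_on S x f"
    by (simp add: eval_on_def scaleC_blinfun.rep_eq scaleC_complex_def)
next
  show "cmod (eval_on S x f) \<le> norm x * norm f" if "f \<in> S" for f
    using that norm_blinfun[of f x] by (simp add: eval_on_def mult.commute)
  show "eval_on S x f = 0" if "f \<notin> S" for f
    using that by (simp add: eval_on_def)
qed

section \<open>Interpolation by vectors on finite sets of functionals\<close>

text \<open>
  A functional vanishing on a common kernel is a linear combination of the given ones; the
  statement records only the consequence that linear functionals on \<open>S\<close> see. In the induction, if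
  \<open>w\<close> is killed by \<open>F\<close> but not by \<open>h\<close>, subtracting a multiple of \<open>h\<close> from \<open>g\<close> gives a functional
  that vanishes on the larger kernel of \<open>F\<close>.
\<close>

lemma vanish_on_common_kernel:
  assumes S: "S \<subseteq> cdual" "csubspace S"
    and m: "\<And>f g. f \<in> S \<Longrightarrow> g \<in> S \<Longrightarrow> m (f + g) = m f + m g"
      "\<And>c f. f \<in> S \<Longrightarrow> m (c *\<^sub>C f) = c * (m f :: complex)"
    and "finite F" "F \<subseteq> S" "\<And>f. f \<in> F \<Longrightarrow> m f = 0"
    and "g \<in> S" "\<And>v. (\<And>f. f \<in> F \<Longrightarrow> blinfun_apply f v = 0) \<Longrightarrow> blinfun_apply g v = 0"
  shows "m g = 0"
  using assms(5-)
proof (induction F arbitrary: g rule: finite_induct)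
  case empty
  then have "g = 0" by (intro blinfun_eqI) simp
  then show ?case using m(2)[OF \<open>g \<in> S\<close>, of 0] by simp
next
  case (insert h F)
  have cd: "h \<in> cdual" "g \<in> cdual" "\<And>f. f \<in> F \<Longrightarrow> f \<in> cdual"
    using insert.prems(1,3) S(1) by auto
  show ?case
  proof (cases "\<exists>w. (\<forall>f\<in>F. blinfun_apply f w = 0) \<and> blinfun_apply h w \<noteq> 0")
    case True
    then obtain w where w: "\<forall>f\<in>F. blinfun_apply f w = 0" "blinfun_apply h w \<noteq> 0" by blast
    define c where "c = - (blinfun_apply g w / blinfun_apply h w)"
    have hS: "h \<in> S" "c *\<^sub>C h \<in> S" using insert.prems(1) S(2) by (auto simp: csubspace_def)
    have "m (g + c *\<^sub>C h) = 0"
    proof (rule insert.IH)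
      show "g + c *\<^sub>C h \<in> S" using insert.prems(3) hS S(2) by (simp add: csubspace_def)
      fix v assume v: "\<And>f. f \<in> F \<Longrightarrow> blinfun_apply f v = 0"
      define d where "d = blinfun_apply h v / blinfun_apply h w"
      \<comment> \<open>The correction by \<open>w\<close> moves \<open>v\<close> into the kernel of \<open>h\<close> without leaving that of \<open>F\<close>.\<close>
      have "blinfun_apply f (v - d *\<^sub>C w) = 0" if "f \<in> insert h F" for f
        using that v w cd by (auto simp: cdual_apply d_def)
      then have "blinfun_apply g (v - d *\<^sub>C w) = 0" by (rule insert.prems(4))
      then show "blinfun_apply (g + c *\<^sub>C h) v = 0"
        by (simp add: cdual_apply[OF cd(2)] blinfun.add_left scaleC_blinfun.rep_eq
            scaleC_complex_def c_def d_def)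
    qed (use insert.prems(1,2) in auto)
    then show ?thesis using m(1)[OF insert.prems(3) hS(2)] m(2)[OF hS(1)] insert.prems(2)[of h] by simp
  next
    case False
    show ?thesis
    proof (rule insert.IH)
      show "blinfun_apply g v = 0" if "\<And>f. f \<in> F \<Longrightarrow> blinfun_apply f v = 0" for v
        using False that by (intro insert.prems(4)) auto
    qed (use insert.prems(1-3) in auto)
  qed
qed

text \<open>
  This is the weak-star density of the space in the dual of \<open>S\<close>, with equality in place of
  approximation. Adding one more functional \<open>g\<close> to \<open>F\<close>, the error of the interpolating
  vector is a linear functional that vanishes on \<open>F\<close>; it can be cancelled at \<open>g\<close> by a vector in the
  common kernel of \<open>F\<close>, unless \<open>g\<close> vanishes there, in which case the error at \<open>g\<close> is already zero.
\<close>

lemma finite_interpolation: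
  assumes S: "S \<subseteq> cdual" "csubspace S" and m: "m \<in> dual_on S"
    and F: "finite F" "F \<subseteq> S"
  shows "\<exists>u. \<forall>f\<in>F. blinfun_apply f u = m f"
  using F
proof (induction F rule: finite_induct)
  case (insert g F)
  then obtain u where u: "\<forall>f\<in>F. blinfun_apply f u = m f" by auto
  have cd: "g \<in> cdual" "\<And>f. f \<in> F \<Longrightarrow> f \<in> cdual" using insert.prems S(1) by auto
  define err where "err = (\<lambda>f. m f - blinfun_apply f u)"
  show ?case
  proof (cases "\<exists>w. (\<forall>f\<in>F. blinfun_apply f w = 0) \<and> blinfun_apply g w \<noteq> 0")
    case True
    then obtain w where w: "\<forall>f\<in>F. blinfun_apply f w = 0" "blinfun_apply g w \<noteq> 0" by blast
    have "\<forall>f\<in>insert g F. blinfun_apply f (u + (err g / blinfun_apply g w) *\<^sub>C w) = m f"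
      using u w cd by (auto simp: cdual_apply err_def)
    then show ?thesis by blast
  next
    case False
    have "err g = 0"
    proof (rule vanish_on_common_kernel[OF S, of err F])
      show "err (f + h) = err f + err h" if "f \<in> S" "h \<in> S" for f h
        using that m by (simp add: err_def dual_on_add blinfun.add_left)
      show "err (c *\<^sub>C f) = c * err f" if "f \<in> S" for c f
        using that m by (simp add: err_def dual_on_scaleC scaleC_blinfun.rep_eq
            scaleC_complex_def right_diff_distrib)
      show "blinfun_apply g v = 0" if "\<And>f. f \<in> F \<Longrightarrow> blinfun_apply f v = 0" for v
        using False that by blast
    qed (use u insert.hyps insert.prems in \<open>auto simp: err_def\<close>)
    then show ?thesis using u by (intro exI[of _ u]) (auto simp: err_def)
  qed
qed simp

section \<open>The bimodule of weak-star weakly continuous functionals\<close>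

lemma clinear_eq_on_tensors:
  assumes S: "bounded_clinear S" and T: "bounded_clinear T"
    and eq: "\<And>a b. S (a \<otimes>\<^sub>\<pi> b) = T (a \<otimes>\<^sub>\<pi> b)"
  shows "S x = T x"
proof -
  have diff: "c *\<^sub>C y - c *\<^sub>C z = c *\<^sub>C (y - z)" for c and y z :: 'c
    using scaleC_add_right[of c "y - z" z] by simp
  have "bounded_clinear (\<lambda>x. S x - T x)"
    using S T by (simp add: bounded_clinear_def bounded_linear_sub diff)
  then have "S x - T x = 0" by (rule clinear_eq_0_on_tensors) (simp add: eq)
  then show ?thesis by simp
qed

lemma tensor_ract_ract: "tensor_ract b (tensor_ract a x) = tensor_ract (a * b) x"
  by (rule clinear_eq_on_tensors[OF bounded_clinear_compose[OF tensor_ract(1) tensor_ract(1)]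
        tensor_ract(1)])
    (simp add: tensor_ract mult.assoc)

lemma tensor_lact_lact: "tensor_lact b (tensor_lact a x) = tensor_lact (b * a) x"
  by (rule clinear_eq_on_tensors[OF bounded_clinear_compose[OF tensor_lact(1) tensor_lact(1)]
        tensor_lact(1)])
    (simp add: tensor_lact mult.assoc)

lemma tensor_lact_ract: "tensor_lact a (tensor_ract b x) = tensor_ract b (tensor_lact a x)"
  by (rule clinear_eq_on_tensors[OF bounded_clinear_compose[OF tensor_lact(1) tensor_ract(1)]
        bounded_clinear_compose[OF tensor_ract(1) tensor_lact(1)]])
    (simp add: tensor_lact tensor_ract)

lemma tensor_mult_lact: "tensor_mult (tensor_lact a x) = a * tensor_mult x"
  by (rule clinear_eq_on_tensors[OF bounded_clinear_compose[OF tensor_mult(1) tensor_lact(1)]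
        bounded_clinear_compose[OF bounded_clinear_mult_right tensor_mult(1)]])
    (simp add: tensor_lact tensor_mult mult.assoc)

lemma tensor_mult_ract: "tensor_mult (tensor_ract a x) = tensor_mult x * a"
  by (rule clinear_eq_on_tensors[OF bounded_clinear_compose[OF tensor_mult(1) tensor_ract(1)]
        bounded_clinear_compose[OF bounded_clinear_mult_left tensor_mult(1)]])
    (simp add: tensor_ract tensor_mult mult.assoc)

lemma form_lact_apply: "blinfun_apply (form_lact a \<phi>) x = blinfun_apply \<phi> (tensor_ract a x)"
  by (simp add: form_lact_def adjoint_op_apply tensor_ract)

lemma form_ract_apply: "blinfun_apply (form_ract a \<phi>) x = blinfun_apply \<phi> (tensor_lact a x)"
  by (simp add: form_ract_def adjoint_op_apply tensor_lact)

lemma form_lact_lact: "form_lact a (form_lact b \<phi>) = form_lact (a * b) \<phi>"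
  by (rule blinfun_eqI) (simp add: form_lact_apply tensor_ract_ract)

lemma form_ract_ract: "form_ract a (form_ract b \<phi>) = form_ract (b * a) \<phi>"
  by (rule blinfun_eqI) (simp add: form_ract_apply tensor_lact_lact)

lemma form_ract_lact: "form_ract a (form_lact b \<phi>) = form_lact b (form_ract a \<phi>)"
  by (rule blinfun_eqI) (simp add: form_lact_apply form_ract_apply tensor_lact_ract)

lemma form_act_cdual:
  assumes "\<phi> \<in> cdual" shows "form_lact a \<phi> \<in> cdual" "form_ract a \<phi> \<in> cdual"
  using assms by (simp_all add: form_lact_def form_ract_def adjoint_op_cdual tensor_lact tensor_ract)

lemma form_act_linear:
  "form_lact a (\<phi> + \<psi>) = form_lact a \<phi> + form_lact a \<psi>"
  "form_ract a (\<phi> + \<psi>) = form_ract a \<phi> + form_ract a \<psi>"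
  "form_lact a (c *\<^sub>C \<phi>) = c *\<^sub>C form_lact a \<phi>"
  "form_ract a (c *\<^sub>C \<phi>) = c *\<^sub>C form_ract a \<phi>"
  by (simp_all add: form_lact_def form_ract_def adjoint_op_add adjoint_op_scaleC tensor_lact tensor_ract)

lemma in_swc_iff:
  "\<phi> \<in> swc P \<longleftrightarrow> \<phi> \<in> cdual \<and> (\<forall>\<Lambda>\<in>dual_on cdual.
     continuous_map (wk_star P) euclidean (\<lambda>a. \<Lambda> (form_lact a \<phi>)) \<and>
     continuous_map (wk_star P) euclidean (\<lambda>a. \<Lambda> (form_ract a \<phi>)))"
  unfolding swc_def sigma_wc_def weak_topology_def continuous_map_sigma_topology_iff
  by (auto simp: form_act_cdual)

lemma swc_cdual: "swc P \<subseteq> cdual"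
  by (auto simp: in_swc_iff)

lemma csubspace_swc: "csubspace (swc P)"
  unfolding csubspace_def
proof (intro conjI ballI allI)
  have zero: "form_lact a 0 = 0" "form_ract a 0 = 0" for a
    using form_act_linear(3,4)[of a 0 0] by simp_all
  show "0 \<in> swc P"
    unfolding in_swc_iff zero by (simp add: csubspace_cdual[unfolded csubspace_def])
next
  fix \<phi> \<psi> assume "\<phi> \<in> swc P" "\<psi> \<in> swc P"
  then show "\<phi> + \<psi> \<in> swc P"
    using csubspace_cdual
    by (auto simp: in_swc_iff form_act_linear dual_on_add form_act_cdual csubspace_def
        intro!: continuous_map_add)
next
  fix c \<phi> assume \<phi>: "\<phi> \<in> swc P"
  then have cd: "\<phi> \<in> cdual" "c *\<^sub>C \<phi> \<in> cdual"
    using csubspace_cdual by (auto simp: in_swc_iff csubspace_def)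
  have mult: "continuous_map (wk_star P) euclidean (\<lambda>a. c * g a)"
    if "continuous_map (wk_star P) euclidean g" for g :: "'a \<Rightarrow> complex"
    using continuous_map_compose[OF that, of euclidean "(*) c"]
    by (simp add: o_def continuous_map_iff_continuous2 continuous_on_mult_left)
  show "c *\<^sub>C \<phi> \<in> swc P"
    unfolding in_swc_iff
  proof (intro conjI ballI cd(2))
    fix \<Lambda> :: "(('a, 'a) ptensor \<Rightarrow>\<^sub>L complex) \<Rightarrow> complex" assume \<Lambda>: "\<Lambda> \<in> dual_on cdual"
    have "continuous_map (wk_star P) euclidean (\<lambda>a. \<Lambda> (form_lact a \<phi>))"
      "continuous_map (wk_star P) euclidean (\<lambda>a. \<Lambda> (form_ract a \<phi>))"
      using \<phi> \<Lambda> by (auto simp: in_swc_iff)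
    from this[THEN mult]
    show "continuous_map (wk_star P) euclidean (\<lambda>a. \<Lambda> (form_lact a (c *\<^sub>C \<phi>)))"
      "continuous_map (wk_star P) euclidean (\<lambda>a. \<Lambda> (form_ract a (c *\<^sub>C \<phi>)))"
      by (simp_all only: form_act_linear dual_on_scaleC[OF \<Lambda>] form_act_cdual[OF cd(1)])
  qed
qed

lemma dual_on_cdual_form_act:
  assumes "\<Lambda> \<in> dual_on cdual"
  shows "adjoint_on cdual (form_lact b) \<Lambda> \<in> dual_on cdual"
    and "adjoint_on cdual (form_ract b) \<Lambda> \<in> dual_on cdual"
  unfolding form_lact_def form_ract_def
  by (rule adjoint_on_dual_on[OF _ csubspace_cdual _ assms];
      simp add: adjoint_op_cdual tensor_ract tensor_lact)+

text \<open>Separate weak-star continuity of the product: the predual is invariant under both actions.\<close>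

lemma continuous_map_wk_star_mult:
  assumes "dual_banach_algebra P"
  shows "continuous_map (wk_star P) (wk_star P) (\<lambda>a. a * b)"
    and "continuous_map (wk_star P) (wk_star P) (\<lambda>a. b * a)"
proof -
  have "continuous_map (wk_star P) euclidean (\<lambda>a. blinfun_apply f (a * b))"
    "continuous_map (wk_star P) euclidean (\<lambda>a. blinfun_apply f (b * a))" if "f \<in> P" for f
    using assms that continuous_map_wk_star_apply[of "adjoint_op (\<lambda>x. x * b) f" P]
      continuous_map_wk_star_apply[of "adjoint_op (\<lambda>x. b * x) f" P]
    by (simp_all add: dual_banach_algebra_def adjoint_op_apply bounded_clinear_mult_left
        bounded_clinear_mult_right)
  then show "continuous_map (wk_star P) (wk_star P) (\<lambda>a. a * b)"
    "continuous_map (wk_star P) (wk_star P) (\<lambda>a. b * a)"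
    unfolding wk_star_def[of P] continuous_map_sigma_topology_iff by auto
qed

text \<open>
  Along the action of \<open>a\<close> on the same side as that of \<open>b\<close>, the orbit map of \<open>b \<cdot> \<phi>\<close> is that of \<open>\<phi>\<close>
  after a multiplication by \<open>b\<close>; on the opposite side it is that of \<open>\<phi>\<close> followed by the weakly
  continuous action of \<open>b\<close>.
\<close>

lemma form_lact_swc:
  assumes P: "dual_banach_algebra P" and \<phi>: "\<phi> \<in> swc P"
  shows "form_lact b \<phi> \<in> swc P"
  unfolding in_swc_iff
proof (intro conjI ballI)
  have cd: "\<phi> \<in> cdual" using \<phi> swc_cdual by auto
  then show "form_lact b \<phi> \<in> cdual" by (rule form_act_cdual)
  fix \<Lambda> :: "(('a, 'a) ptensor \<Rightarrow>\<^sub>L complex) \<Rightarrow> complex" assume \<Lambda>: "\<Lambda> \<in> dual_on cdual"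
  have "continuous_map (wk_star P) euclidean (\<lambda>a. \<Lambda> (form_lact a \<phi>))"
    using \<phi> \<Lambda> by (simp add: in_swc_iff)
  from continuous_map_compose[OF continuous_map_wk_star_mult(1)[OF P] this]
  show "continuous_map (wk_star P) euclidean (\<lambda>a. \<Lambda> (form_lact a (form_lact b \<phi>)))"
    by (simp add: form_lact_lact o_def)
  have "continuous_map (wk_star P) euclidean
      (\<lambda>a. adjoint_on cdual (form_lact b) \<Lambda> (form_ract a \<phi>))"
    using \<phi> dual_on_cdual_form_act(1)[OF \<Lambda>] by (simp add: in_swc_iff)
  then show "continuous_map (wk_star P) euclidean (\<lambda>a. \<Lambda> (form_ract a (form_lact b \<phi>)))"
    by (simp add: adjoint_on_def form_act_cdual cd form_ract_lact)
qed

lemma form_ract_swc: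
  assumes P: "dual_banach_algebra P" and \<phi>: "\<phi> \<in> swc P"
  shows "form_ract b \<phi> \<in> swc P"
  unfolding in_swc_iff
proof (intro conjI ballI)
  have cd: "\<phi> \<in> cdual" using \<phi> swc_cdual by auto
  then show "form_ract b \<phi> \<in> cdual" by (rule form_act_cdual)
  fix \<Lambda> :: "(('a, 'a) ptensor \<Rightarrow>\<^sub>L complex) \<Rightarrow> complex" assume \<Lambda>: "\<Lambda> \<in> dual_on cdual"
  have "continuous_map (wk_star P) euclidean
      (\<lambda>a. adjoint_on cdual (form_ract b) \<Lambda> (form_lact a \<phi>))"
    using \<phi> dual_on_cdual_form_act(2)[OF \<Lambda>] by (simp add: in_swc_iff)
  then show "continuous_map (wk_star P) euclidean (\<lambda>a. \<Lambda> (form_lact a (form_ract b \<phi>)))"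
    by (simp add: adjoint_on_def form_act_cdual cd flip: form_ract_lact)
  have "continuous_map (wk_star P) euclidean (\<lambda>a. \<Lambda> (form_ract a \<phi>))"
    using \<phi> \<Lambda> by (simp add: in_swc_iff)
  from continuous_map_compose[OF continuous_map_wk_star_mult(2)[OF P] this]
  show "continuous_map (wk_star P) euclidean (\<lambda>a. \<Lambda> (form_ract a (form_ract b \<phi>)))"
    by (simp add: form_ract_ract o_def)
qed

lemma form_act_adjoint_mult:
  "form_lact a (adjoint_op tensor_mult f) = adjoint_op tensor_mult (adjoint_op (\<lambda>x. x * a) f)"
  "form_ract a (adjoint_op tensor_mult f) = adjoint_op tensor_mult (adjoint_op (\<lambda>x. a * x) f)"
  by (rule blinfun_eqI; simp add: form_lact_apply form_ract_apply adjoint_op_apply tensor_mult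
      tensor_mult_lact tensor_mult_ract bounded_clinear_mult_left bounded_clinear_mult_right)+

text \<open>
  The orbit maps of \<open>\<pi>\<^sup>* f\<close> are those of \<open>f\<close> followed by \<open>\<pi>\<^sup>*\<close>, and the orbits of \<open>f\<close> stay in \<open>P\<close>.
  A bounded functional \<open>\<Lambda>\<close> composed with \<open>\<pi>\<^sup>*\<close> is, on \<open>P\<close>, evaluation at an element \<open>c\<close> of the
  algebra, as this is the dual of \<open>P\<close>. So the functions to be continuous are
  \<open>a \<mapsto> f (c * a)\<close> and \<open>a \<mapsto> f (a * c)\<close>.
\<close>

lemma adjoint_mult_swc:
  assumes P: "dual_banach_algebra P" and f: "f \<in> P"
  shows "adjoint_op tensor_mult f \<in> swc P"
  unfolding in_swc_iff
proof (intro conjI ballI)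
  have sub: "P \<subseteq> cdual" "csubspace P" and surj: "eval_on P ` UNIV = dual_on P"
    and act: "\<And>a. adjoint_op (\<lambda>x. x * a) f \<in> P" "\<And>a. adjoint_op (\<lambda>x. a * x) f \<in> P"
    using P f by (auto simp: dual_banach_algebra_def bij_betw_def)
  show "adjoint_op tensor_mult f \<in> cdual" using f sub by (intro adjoint_op_cdual tensor_mult) auto
  fix \<Lambda> :: "(('a, 'a) ptensor \<Rightarrow>\<^sub>L complex) \<Rightarrow> complex" assume \<Lambda>: "\<Lambda> \<in> dual_on cdual"
  have "adjoint_on P (adjoint_op tensor_mult) \<Lambda> \<in> dual_on P"
    using sub by (intro adjoint_on_dual_on[OF _ _ _ \<Lambda>] adjoint_op_cdual tensor_mult) auto
  then obtain c where "adjoint_on P (adjoint_op tensor_mult) \<Lambda> = eval_on P c" using surj by blast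
  then have c: "\<Lambda> (adjoint_op tensor_mult g) = blinfun_apply g c" if "g \<in> P" for g
    using that by (simp add: fun_eq_iff adjoint_on_def eval_on_def split: if_splits)
  note mult = continuous_map_compose[OF continuous_map_wk_star_mult(1)[OF P, of c]
      continuous_map_wk_star_apply[OF f]]
    continuous_map_compose[OF continuous_map_wk_star_mult(2)[OF P, of c]
      continuous_map_wk_star_apply[OF f]]
  show "continuous_map (wk_star P) euclidean (\<lambda>a. \<Lambda> (form_lact a (adjoint_op tensor_mult f)))"
    using mult by (simp add: form_act_adjoint_mult c act adjoint_op_apply bounded_clinear_mult_left o_def)
  show "continuous_map (wk_star P) euclidean (\<lambda>a. \<Lambda> (form_ract a (adjoint_op tensor_mult f)))"
    using mult by (simp add: form_act_adjoint_mult c act adjoint_op_apply bounded_clinear_mult_right o_def)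
qed

lemma pi_swc_apply:
  assumes P: "dual_banach_algebra P" and m: "m \<in> dual_on (swc P)" and f: "f \<in> P"
  shows "blinfun_apply f (pi_swc P m) = m (adjoint_op tensor_mult f)"
proof -
  have "csubspace P" and bij: "inj (eval_on P)" "range (eval_on P) = dual_on P"
    using P by (auto simp: dual_banach_algebra_def bij_betw_def)
  then have "adjoint_on P (adjoint_op tensor_mult) m \<in> range (eval_on P)"
    using adjoint_on_dual_on[OF tensor_mult(1) _ adjoint_mult_swc[OF P] m] by simp
  then have "eval_on P (pi_swc P m) = adjoint_on P (adjoint_op tensor_mult) m"
    unfolding pi_swc_def using bij(1) by (intro f_the_inv_into_f) auto
  from fun_cong[OF this, of f] f show ?thesis by (simp add: eval_on_def adjoint_on_def)
qed

section \<open>Convergence tests\<close>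

lemma swc_dual_commutator_dual_on:
  assumes P: "dual_banach_algebra P" and m: "m \<in> dual_on (swc P)"
  shows "(\<lambda>\<phi>. swc_dual_lact P a m \<phi> - swc_dual_ract P a m \<phi>) \<in> dual_on (swc P)"
proof (rule dual_on_diff)
  show "swc_dual_lact P a m \<in> dual_on (swc P)"
    unfolding swc_dual_lact_def form_ract_def
    using form_ract_swc[OF P] tensor_lact
    by (intro adjoint_on_dual_on[OF _ csubspace_swc _ m]) (auto simp: form_ract_def)
  show "swc_dual_ract P a m \<in> dual_on (swc P)"
    unfolding swc_dual_ract_def form_lact_def
    using form_lact_swc[OF P] tensor_ract
    by (intro adjoint_on_dual_on[OF _ csubspace_swc _ m]) (auto simp: form_lact_def)
qed

lemma limitin_commutator_iff:
  assumes P: "dual_banach_algebra P" and m: "eventually (\<lambda>i. m i \<in> dual_on (swc P)) F"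
  shows "limitin (weak_star_topology (swc P))
      (\<lambda>i \<phi>. swc_dual_lact P a (m i) \<phi> - swc_dual_ract P a (m i) \<phi>) (\<lambda>\<phi>. 0) F \<longleftrightarrow>
    (\<forall>\<phi>\<in>swc P. ((\<lambda>i. m i (form_ract a \<phi>) - m i (form_lact a \<phi>)) \<longlongrightarrow> 0) F)"
proof -
  have "(\<lambda>\<phi>. 0) \<in> dual_on (swc P)" by (auto simp: dual_on_def intro: exI[of _ 0])
  moreover have "eventually (\<lambda>i. (\<lambda>\<phi>. swc_dual_lact P a (m i) \<phi> - swc_dual_ract P a (m i) \<phi>)
      \<in> dual_on (swc P)) F"
    using m by eventually_elim (rule swc_dual_commutator_dual_on[OF P])
  ultimately show ?thesis
    unfolding weak_star_topology_def limitin_sigma_topology_iff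
    by (simp add: swc_dual_lact_def swc_dual_ract_def adjoint_on_def)
qed

text \<open>
  Moving the factor \<open>a\<close> onto the predual functional \<open>f\<close> leaves \<open>\<pi>\<close> alone on the other side, where
  it is the adjoint of \<open>\<pi>\<^sup>*\<close>; the limit becomes one of values of the net at a functional in \<open>swc P\<close>.
\<close>

lemma limitin_mult_pi_swc_iff:
  assumes P: "dual_banach_algebra P" and m: "eventually (\<lambda>i. m i \<in> dual_on (swc P)) F"
  shows "limitin (wk_star P) (\<lambda>i. a * pi_swc P (m i)) a F \<longleftrightarrow>
    (\<forall>f\<in>P. ((\<lambda>i. m i (adjoint_op tensor_mult (adjoint_op (\<lambda>x. a * x) f))) \<longlongrightarrow> blinfun_apply f a) F)"
proof -
  have "((\<lambda>i. blinfun_apply f (a * pi_swc P (m i))) \<longlongrightarrow> blinfun_apply f a) F \<longleftrightarrow>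
      ((\<lambda>i. m i (adjoint_op tensor_mult (adjoint_op (\<lambda>x. a * x) f))) \<longlongrightarrow> blinfun_apply f a) F"
    if f: "f \<in> P" for f
  proof (rule tendsto_cong)
    have "adjoint_op (\<lambda>x. a * x) f \<in> P" using P f by (simp add: dual_banach_algebra_def)
    from pi_swc_apply[OF P _ this]
    have eq: "blinfun_apply f (a * pi_swc P n) = n (adjoint_op tensor_mult (adjoint_op (\<lambda>x. a * x) f))"
      if "n \<in> dual_on (swc P)" for n
      using that by (simp add: adjoint_op_apply bounded_clinear_mult_right)
    show "eventually (\<lambda>i. blinfun_apply f (a * pi_swc P (m i)) =
        m i (adjoint_op tensor_mult (adjoint_op (\<lambda>x. a * x) f))) F"
      using m by eventually_elim (rule eq)
  qed
  then show ?thesis unfolding wk_star_def limitin_sigma_topology_iff by simp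
qed

section \<open>Refining a net by finite sets\<close>

definition refine_le :: "('i \<Rightarrow> 'i \<Rightarrow> bool) \<Rightarrow> 'i \<times> 's set \<Rightarrow> 'i \<times> 's set \<Rightarrow> bool" where
  "refine_le le p q \<longleftrightarrow> le (fst p) (fst q) \<and> snd p \<subseteq> snd q"

lemma directed_refine_le:
  assumes "directed I le"
  shows "directed (I \<times> Fpow S) (refine_le le)"
  unfolding directed_def
proof (intro conjI ballI impI)
  have ne: "I \<noteq> {}" and refl: "\<And>i. i \<in> I \<Longrightarrow> le i i"
    and trans: "\<And>i j k. i \<in> I \<Longrightarrow> j \<in> I \<Longrightarrow> k \<in> I \<Longrightarrow> le i j \<Longrightarrow> le j k \<Longrightarrow> le i k"
    and ub: "\<And>i j. i \<in> I \<Longrightarrow> j \<in> I \<Longrightarrow> \<exists>k\<in>I. le i k \<and> le j k"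
    using assms unfolding directed_def by blast+
  show "I \<times> Fpow S \<noteq> {}" using ne by (auto simp: Fpow_def)
  fix p assume p: "p \<in> I \<times> Fpow S"
  then show "refine_le le p p" using refl by (auto simp: refine_le_def)
  fix q assume q: "q \<in> I \<times> Fpow S"
  obtain k where "k \<in> I" "le (fst p) k" "le (fst q) k" using ub[of "fst p" "fst q"] p q by auto
  with p q show "\<exists>r\<in>I \<times> Fpow S. refine_le le p r \<and> refine_le le q r"
    by (intro bexI[of _ "(k, snd p \<union> snd q)"]) (auto simp: refine_le_def Fpow_def)
  fix r assume r: "r \<in> I \<times> Fpow S" and le: "refine_le le p q" "refine_le le q r"
  have "le (fst p) (fst r)"
    using le p q r by (intro trans[of "fst p" "fst q" "fst r"]) (auto simp: refine_le_def)
  then show "refine_le le p r" using le by (auto simp: refine_le_def)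
qed

lemma filterlim_fst_refine:
  assumes "directed I le"
  shows "filterlim fst (net_filter I le) (net_filter (I \<times> Fpow S) (refine_le le))"
  unfolding filterlim_iff eventually_net_filter[OF assms]
    eventually_net_filter[OF directed_refine_le[OF assms]]
proof (intro allI impI)
  fix Q assume "\<exists>i\<in>I. \<forall>j\<in>I. le i j \<longrightarrow> Q j"
  then obtain i where "i \<in> I" "\<forall>j\<in>I. le i j \<longrightarrow> Q j" by blast
  then show "\<exists>p\<in>I \<times> Fpow S. \<forall>q\<in>I \<times> Fpow S. refine_le le p q \<longrightarrow> Q (fst q)"
    by (intro bexI[of _ "(i, {})"]) (auto simp: refine_le_def Fpow_def)
qed

lemma eventually_mem_refine:
  assumes "directed I le" "s \<in> S"
  shows "eventually (\<lambda>p. p \<in> I \<times> Fpow S \<and> s \<in> snd p) (net_filter (I \<times> Fpow S) (refine_le le))"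
proof -
  obtain i where "i \<in> I" using assms(1) by (auto simp: directed_def)
  then show ?thesis
    unfolding eventually_net_filter[OF directed_refine_le[OF assms(1)]]
    by (intro bexI[of _ "(i, {s})"]) (use assms(2) in \<open>auto simp: refine_le_def Fpow_def\<close>)
qed

section \<open>From functionals to tensors\<close>

theorem proposition2p2:
  fixes P :: "('a::complex_banach_algebra \<Rightarrow>\<^sub>L complex) set"
  assumes "dual_banach_algebra P"
    and "strong_pseudo_Connes_amenable TYPE('i) P"
  shows "pseudo_Connes_amenable TYPE(('a, 'a) ptensor set \<times> ('a, 'a) ptensor) P"
proof -
  note P = assms(1)
  let ?S = "swc P"
  obtain I :: "'i set" and le m where net: "directed I le \<and> (\<forall>i\<in>I. m i \<in> dual_on ?S) \<and>
      (\<forall>a. limitin (weak_star_topology ?S)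
          (\<lambda>i \<phi>. swc_dual_lact P a (m i) \<phi> - swc_dual_ract P a (m i) \<phi>) (\<lambda>\<phi>. 0) (net_filter I le) \<and>
        (\<forall>i\<in>I. a * pi_swc P (m i) = pi_swc P (m i) * a) \<and>
        limitin (wk_star P) (\<lambda>i. a * pi_swc P (m i)) a (net_filter I le))"
    using assms(2) unfolding strong_pseudo_Connes_amenable_def by (elim exE) (rule that)
  note dir = net[THEN conjunct1] and m = net[THEN conjunct2, THEN conjunct1, rule_format]
    and lim = net[THEN conjunct2, THEN conjunct2, rule_format]
  note lim1 = lim[THEN conjunct1] and lim2 = lim[THEN conjunct2, THEN conjunct2]
  obtain i where "i \<in> I" using dir by (auto simp: directed_def)
  then have ev_m: "eventually (\<lambda>i. m i \<in> dual_on ?S) (net_filter I le)"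
    unfolding eventually_net_filter[OF dir] using m by blast
  define J where "J = I \<times> Fpow ?S"
  define N where "N = net_filter J (refine_le le)"
  have "\<exists>v. \<forall>\<phi>\<in>snd p. blinfun_apply \<phi> v = m (fst p) \<phi>" if "p \<in> J" for p
    by (rule finite_interpolation[OF swc_cdual csubspace_swc]) (use that m in \<open>auto simp: J_def Fpow_def\<close>)
  then obtain u where u: "\<And>p \<phi>. p \<in> J \<Longrightarrow> \<phi> \<in> snd p \<Longrightarrow> blinfun_apply \<phi> (u p) = m (fst p) \<phi>"
    by metis
  define ev where "ev p = eval_on ?S (u p)" for p
  have ev_dual: "eventually (\<lambda>p. ev p \<in> dual_on ?S) N"
    by (simp add: ev_def eval_on_dual_on[OF csubspace_swc])
  have agree: "eventually (\<lambda>p. ev p \<phi> = m (fst p) \<phi>) N" if "\<phi> \<in> ?S" for \<phi>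
    using eventually_mem_refine[OF dir that] unfolding N_def J_def[symmetric]
    by eventually_elim (simp add: that u ev_def eval_on_def)
  have fst_lim: "filterlim fst (net_filter I le) N"
    unfolding N_def J_def by (rule filterlim_fst_refine[OF dir])
  have new1: "limitin (weak_star_topology ?S)
      (\<lambda>p \<phi>. swc_dual_lact P a (ev p) \<phi> - swc_dual_ract P a (ev p) \<phi>) (\<lambda>\<phi>. 0) N" for a
    unfolding limitin_commutator_iff[OF P ev_dual]
  proof
    fix \<phi> assume \<phi>: "\<phi> \<in> ?S"
    have "((\<lambda>i. m i (form_ract a \<phi>) - m i (form_lact a \<phi>)) \<longlongrightarrow> 0) (net_filter I le)"
      using lim1[of a] \<phi> unfolding limitin_commutator_iff[OF P ev_m] by blast
    from filterlim_compose[OF this fst_lim]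
    have "((\<lambda>p. m (fst p) (form_ract a \<phi>) - m (fst p) (form_lact a \<phi>)) \<longlongrightarrow> 0) N" .
    moreover have "eventually (\<lambda>p. m (fst p) (form_ract a \<phi>) - m (fst p) (form_lact a \<phi>) =
        ev p (form_ract a \<phi>) - ev p (form_lact a \<phi>)) N"
      using agree[OF form_ract_swc[OF P \<phi>, of a]] agree[OF form_lact_swc[OF P \<phi>, of a]]
      by eventually_elim simp
    ultimately show "((\<lambda>p. ev p (form_ract a \<phi>) - ev p (form_lact a \<phi>)) \<longlongrightarrow> 0) N"
      by (rule Lim_transform_eventually)
  qed
  have new2: "limitin (wk_star P) (\<lambda>p. a * pi_swc P (ev p)) a N" for a
    unfolding limitin_mult_pi_swc_iff[OF P ev_dual]
  proof
    fix f assume f: "f \<in> P"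
    let ?\<phi> = "adjoint_op tensor_mult (adjoint_op (\<lambda>x. a * x) f)"
    have \<phi>: "?\<phi> \<in> ?S" using P f by (intro adjoint_mult_swc) (auto simp: dual_banach_algebra_def)
    have "((\<lambda>i. m i ?\<phi>) \<longlongrightarrow> blinfun_apply f a) (net_filter I le)"
      using lim2[of a] f unfolding limitin_mult_pi_swc_iff[OF P ev_m] by blast
    from filterlim_compose[OF this fst_lim]
    have "((\<lambda>p. m (fst p) ?\<phi>) \<longlongrightarrow> blinfun_apply f a) N" .
    moreover have "eventually (\<lambda>p. m (fst p) ?\<phi> = ev p ?\<phi>) N"
      using agree[OF \<phi>] by eventually_elim simp
    ultimately show "((\<lambda>p. ev p ?\<phi>) \<longlongrightarrow> blinfun_apply f a) N"
      by (rule Lim_transform_eventually)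
  qed
  have "directed J (refine_le le)"
    unfolding J_def by (rule directed_refine_le[OF dir])
  then have "pseudo_Connes_amenable TYPE('i \<times> (('a, 'a) ptensor \<Rightarrow>\<^sub>L complex) set) P"
    unfolding pseudo_Connes_amenable_def
    using new1[unfolded N_def ev_def] new2[unfolded N_def ev_def]
    by (intro exI[of _ J] exI[of _ "refine_le le"] exI[of _ u] conjI allI)
  then show ?thesis by (rule pseudo_Connes_amenable_reindex)
qed

end
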